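(* Let $(M^3,g,f)$ be the spatial factor of a static perfect fluid space-time with density $\mu$ and pressure $\rho$, such that $\mu=\mu(\rho)$ is a smooth function of $\rho$. Let $c,d\in\mathbb{R}$ and $$F(f)=(cf^2+d)(1-f^2)^{-3},\qquad G(f)=\frac{6F}{1-f^2}-2c(1-f^2)^{-3}.$$ Then, at all points where $\nabla f\neq0$ and $f\ne 1$, $$\begin{aligned} &\mathrm{div}\left[F\left(f^{-1}\nabla|\nabla f|^2+8\pi(\mu-\rho)\nabla f\right)+G|\nabla f|^2\nabla f\right]\\ &=\frac{Ff^3|C|^2}{4|\nabla f|^2}-\frac{F\Delta f}{f|\nabla f|^2}\langle\nabla|\nabla f|^2,\nabla f\rangle+\frac{3F}{4f|\nabla f|^2}\left|\nabla|\nabla f|^2+8\,\frac{f|\nabla f|^2\nabla f}{1-f^2}\right|^2\\ &\quad+4\pi(3\mu+\rho)F\Delta f+\frac{96\pi fF}{1-f^2}|\nabla f|^2(\mu-\rho)+4\pi|\nabla f|^2\left[(5\rho-\mu)fG+4F\frac{d\mu}{df}\right]. \end{aligned}$$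
   Context: A Riemannian manifold $(M^3,g)$ is the spatial factor of a static perfect fluid space-time if there are smooth functions $\mu,\rho,f$ on $M$ with $f>0$ satisfying $$f\,Ric=\nabla^2 f+4\pi(\mu-\rho)fg,\qquad \Delta f=4\pi(\mu+3\rho)f,$$ where $Ric$, $\nabla^2$, $\Delta$ are the Ricci tensor, Hessian and Laplacian (trace of the Hessian) of $g$. The scalar curvature is denoted $R$. The Cotton tensor is $$C_{ijk}=\nabla_iR_{jk}-\nabla_jR_{ik}-\tfrac14\left(\nabla_iR\,g_{jk}-\nabla_jR\,g_{ik}\right),$$ and $|C|^2=C_{ijk}C^{ijk}$. Under these equations $\nabla\rho=-f^{-1}(\mu+\rho)\nabla f$; since $\mu=\mu(\rho)$, the density is regarded as a function of $f$, and $\frac{d\mu}{df}$ denotes the function $-f^{-1}(\mu+\rho)\frac{d\mu}{d\rho}$, so that $\nabla\mu=\frac{d\mu}{df}\nabla f$. *)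

theory Defs
  imports "HOL-Analysis.Analysis"
begin

section \<open>Smooth functions\<close>

primrec dirderivs ::
  "'a::real_normed_vector list \<Rightarrow> ('a \<Rightarrow> 'b::real_normed_vector) \<Rightarrow> 'a \<Rightarrow> 'b" where
  "dirderivs [] u = u"
| "dirderivs (v # vs) u = (\<lambda>x. frechet_derivative (dirderivs vs u) (at x) v)"

text \<open>Only used for open sets in finite-dimensional spaces, where existence and
  differentiability of all iterated directional derivatives is the same as being
  infinitely often continuously differentiable.\<close>

definition smooth_on ::
  "'a::real_normed_vector set \<Rightarrow> ('a \<Rightarrow> 'b::real_normed_vector) \<Rightarrow> bool" where
  "smooth_on S u \<longleftrightarrow> (\<forall>vs. \<forall>x\<in>S. dirderivs vs u differentiable (at x))"


section \<open>Smooth manifolds and Riemannian metrics\<close>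

text \<open>A chart is a pair of its domain and its coordinate map. The underlying space of the
  manifold is \<open>topspace X\<close>; the atlas is not required to be maximal.\<close>

type_synonym ('a, 'n) chart = "'a set \<times> ('a \<Rightarrow> real ^ 'n)"

abbreviation chart_dom :: "('a, 'n) chart \<Rightarrow> 'a set" where
  "chart_dom ch \<equiv> fst ch"

definition chart_image :: "('a, 'n) chart \<Rightarrow> (real ^ 'n) set" where
  "chart_image ch = snd ch ` fst ch"

definition chart_inv :: "('a, 'n) chart \<Rightarrow> real ^ 'n \<Rightarrow> 'a" where
  "chart_inv ch = inv_into (fst ch) (snd ch)"

definition smooth_manifold :: "'a topology \<Rightarrow> ('a, 'n::finite) chart set \<Rightarrow> bool" where
  "smooth_manifold X A \<longleftrightarrow>
     Hausdorff_space X \<and> second_countable X \<and>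
     (\<Union>ch\<in>A. chart_dom ch) = topspace X \<and>
     (\<forall>ch\<in>A. openin X (chart_dom ch) \<and> open (chart_image ch) \<and>
        homeomorphic_map (subtopology X (chart_dom ch)) (top_of_set (chart_image ch)) (snd ch)) \<and>
     (\<forall>ch\<in>A. \<forall>ch'\<in>A.
        smooth_on (snd ch ` (chart_dom ch \<inter> chart_dom ch')) (snd ch' \<circ> chart_inv ch))"

definition smooth_function :: "('a, 'n::finite) chart set \<Rightarrow> ('a \<Rightarrow> real) \<Rightarrow> bool" where
  "smooth_function A u \<longleftrightarrow> (\<forall>ch\<in>A. smooth_on (chart_image ch) (u \<circ> chart_inv ch))"

text \<open>Partial derivative \<open>\<partial>\<^sub>i u\<close> at the point \<open>p\<close> of the manifold, in the coordinates
  of the chart \<open>ch\<close>.\<close>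

definition pd :: "('a, 'n::finite) chart \<Rightarrow> 'n \<Rightarrow> ('a \<Rightarrow> real) \<Rightarrow> 'a \<Rightarrow> real" where
  "pd ch i u p = frechet_derivative (u \<circ> chart_inv ch) (at (snd ch p)) (axis i 1)"

text \<open>A metric is given by its components: \<open>g ch p $ i $ j\<close> is \<open>g\<^sub>i\<^sub>j\<close> at \<open>p\<close> in the chart
  \<open>ch\<close>. The last conjunct is the transformation law of a covariant 2-tensor, which says
  that these components come from one bilinear form on each tangent space.\<close>

type_synonym ('a, 'n) metric = "('a, 'n) chart \<Rightarrow> 'a \<Rightarrow> real ^ 'n ^ 'n"

definition riemannian_metric :: "('a, 'n::finite) chart set \<Rightarrow> ('a, 'n) metric \<Rightarrow> bool" where
  "riemannian_metric A g \<longleftrightarrow>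
     (\<forall>ch\<in>A. \<forall>i j. smooth_on (chart_image ch) (\<lambda>x. g ch (chart_inv ch x) $ i $ j)) \<and>
     (\<forall>ch\<in>A. \<forall>p\<in>chart_dom ch.
        transpose (g ch p) = g ch p \<and> (\<forall>v. v \<noteq> 0 \<longrightarrow> v \<bullet> (g ch p *v v) > 0)) \<and>
     (\<forall>ch\<in>A. \<forall>ch'\<in>A. \<forall>p\<in>chart_dom ch \<inter> chart_dom ch'. \<forall>i j.
        g ch p $ i $ j =
        (\<Sum>k\<in>UNIV. \<Sum>l\<in>UNIV. pd ch i (\<lambda>q. snd ch' q $ k) p *
            pd ch j (\<lambda>q. snd ch' q $ l) p * g ch' p $ k $ l))"


section \<open>Tensor calculus of the Levi-Civita connection\<close>

text \<open>All tensors are given by their components in a chart \<open>ch\<close>, as functions of the point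
  \<open>p\<close> of the manifold. Vector fields have contravariant components, all other tensors are
  covariant.\<close>

definition ginv :: "('a, 'n::finite) metric \<Rightarrow> ('a, 'n) chart \<Rightarrow> 'a \<Rightarrow> 'n \<Rightarrow> 'n \<Rightarrow> real" where
  "ginv g ch p i j = matrix_inv (g ch p) $ i $ j"

text \<open>\<open>christoffel g ch k i j p\<close> is \<open>\<Gamma>\<^sup>k\<^sub>i\<^sub>j\<close>.\<close>

definition christoffel ::
  "('a, 'n::finite) metric \<Rightarrow> ('a, 'n) chart \<Rightarrow> 'n \<Rightarrow> 'n \<Rightarrow> 'n \<Rightarrow> 'a \<Rightarrow> real" where
  "christoffel g ch k i j p =
     (\<Sum>l\<in>UNIV. ginv g ch p k l *
        (pd ch i (\<lambda>q. g ch q $ j $ l) p + pd ch j (\<lambda>q. g ch q $ i $ l) p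
          - pd ch l (\<lambda>q. g ch q $ i $ j) p)) / 2"

text \<open>\<open>riemann g ch l i j k\<close> is the component along \<open>\<partial>\<^sub>l\<close> of \<open>R(\<partial>\<^sub>i, \<partial>\<^sub>j)\<partial>\<^sub>k\<close>, where
  \<open>R(X, Y)Z = \<nabla>\<^sub>X\<nabla>\<^sub>Y Z - \<nabla>\<^sub>Y\<nabla>\<^sub>X Z - \<nabla>\<^bsub>[X,Y]\<^esub> Z\<close>; the Ricci tensor is the trace of
  \<open>X \<mapsto> R(X, Y)Z\<close>, so round spheres have positive Ricci curvature.\<close>

definition riemann ::
  "('a, 'n::finite) metric \<Rightarrow> ('a, 'n) chart \<Rightarrow> 'n \<Rightarrow> 'n \<Rightarrow> 'n \<Rightarrow> 'n \<Rightarrow> 'a \<Rightarrow> real" where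
  "riemann g ch l i j k p =
     pd ch i (christoffel g ch l j k) p - pd ch j (christoffel g ch l i k) p
     + (\<Sum>m\<in>UNIV. christoffel g ch l i m p * christoffel g ch m j k p
                  - christoffel g ch l j m p * christoffel g ch m i k p)"

definition ricci :: "('a, 'n::finite) metric \<Rightarrow> ('a, 'n) chart \<Rightarrow> 'n \<Rightarrow> 'n \<Rightarrow> 'a \<Rightarrow> real" where
  "ricci g ch j k p = (\<Sum>i\<in>UNIV. riemann g ch i i j k p)"

definition trace2 ::
  "('a, 'n::finite) metric \<Rightarrow> ('a, 'n) chart \<Rightarrow> ('n \<Rightarrow> 'n \<Rightarrow> 'a \<Rightarrow> real) \<Rightarrow> 'a \<Rightarrow> real" where
  "trace2 g ch T p = (\<Sum>i\<in>UNIV. \<Sum>j\<in>UNIV. ginv g ch p i j * T i j p)"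

definition scalar_curvature :: "('a, 'n::finite) metric \<Rightarrow> ('a, 'n) chart \<Rightarrow> 'a \<Rightarrow> real" where
  "scalar_curvature g ch = trace2 g ch (ricci g ch)"

text \<open>The first index of \<open>nabla1\<close> and \<open>nabla2\<close> is the direction of differentiation.\<close>

definition nabla1 ::
  "('a, 'n::finite) metric \<Rightarrow> ('a, 'n) chart \<Rightarrow> ('n \<Rightarrow> 'a \<Rightarrow> real) \<Rightarrow> 'n \<Rightarrow> 'n \<Rightarrow> 'a \<Rightarrow> real" where
  "nabla1 g ch \<alpha> i j p = pd ch i (\<alpha> j) p - (\<Sum>k\<in>UNIV. christoffel g ch k i j p * \<alpha> k p)"

definition nabla2 ::
  "('a, 'n::finite) metric \<Rightarrow> ('a, 'n) chart \<Rightarrow> ('n \<Rightarrow> 'n \<Rightarrow> 'a \<Rightarrow> real)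
     \<Rightarrow> 'n \<Rightarrow> 'n \<Rightarrow> 'n \<Rightarrow> 'a \<Rightarrow> real" where
  "nabla2 g ch T i j k p =
     pd ch i (T j k) p
     - (\<Sum>l\<in>UNIV. christoffel g ch l i j p * T l k p + christoffel g ch l i k p * T j l p)"

definition hessian ::
  "('a, 'n::finite) metric \<Rightarrow> ('a, 'n) chart \<Rightarrow> ('a \<Rightarrow> real) \<Rightarrow> 'n \<Rightarrow> 'n \<Rightarrow> 'a \<Rightarrow> real" where
  "hessian g ch u = nabla1 g ch (\<lambda>j. pd ch j u)"

definition laplacian ::
  "('a, 'n::finite) metric \<Rightarrow> ('a, 'n) chart \<Rightarrow> ('a \<Rightarrow> real) \<Rightarrow> 'a \<Rightarrow> real" where
  "laplacian g ch u = trace2 g ch (hessian g ch u)"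

definition grad ::
  "('a, 'n::finite) metric \<Rightarrow> ('a, 'n) chart \<Rightarrow> ('a \<Rightarrow> real) \<Rightarrow> 'a \<Rightarrow> real ^ 'n" where
  "grad g ch u p = (\<chi> i. \<Sum>j\<in>UNIV. ginv g ch p i j * pd ch j u p)"

definition ginner ::
  "('a, 'n::finite) metric \<Rightarrow> ('a, 'n) chart \<Rightarrow> 'a \<Rightarrow> real ^ 'n \<Rightarrow> real ^ 'n \<Rightarrow> real" where
  "ginner g ch p v w = v \<bullet> (g ch p *v w)"

definition gnorm2 ::
  "('a, 'n::finite) metric \<Rightarrow> ('a, 'n) chart \<Rightarrow> 'a \<Rightarrow> real ^ 'n \<Rightarrow> real" where
  "gnorm2 g ch p v = ginner g ch p v v"

text \<open>\<open>\<nabla>\<^sub>i V\<^sup>i\<close>, the trace of the covariant derivative of the vector field \<open>V\<close>.\<close>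

definition divergence ::
  "('a, 'n::finite) metric \<Rightarrow> ('a, 'n) chart \<Rightarrow> ('a \<Rightarrow> real ^ 'n) \<Rightarrow> 'a \<Rightarrow> real" where
  "divergence g ch V p =
     (\<Sum>i\<in>UNIV. pd ch i (\<lambda>q. V q $ i) p + (\<Sum>k\<in>UNIV. christoffel g ch i i k p * V p $ k))"

definition tensor3_norm2 ::
  "('a, 'n::finite) metric \<Rightarrow> ('a, 'n) chart \<Rightarrow> ('n \<Rightarrow> 'n \<Rightarrow> 'n \<Rightarrow> 'a \<Rightarrow> real) \<Rightarrow> 'a \<Rightarrow> real" where
  "tensor3_norm2 g ch T p =
     (\<Sum>i\<in>UNIV. \<Sum>j\<in>UNIV. \<Sum>k\<in>UNIV. \<Sum>a\<in>UNIV. \<Sum>b\<in>UNIV. \<Sum>c\<in>UNIV.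
        ginv g ch p i a * ginv g ch p j b * ginv g ch p k c * T i j k p * T a b c p)"

definition cotton :: "('a, 3) metric \<Rightarrow> ('a, 3) chart \<Rightarrow> 3 \<Rightarrow> 3 \<Rightarrow> 3 \<Rightarrow> 'a \<Rightarrow> real" where
  "cotton g ch i j k p =
     nabla2 g ch (ricci g ch) i j k p - nabla2 g ch (ricci g ch) j i k p
     - 1 / 4 * (pd ch i (scalar_curvature g ch) p * g ch p $ j $ k
                - pd ch j (scalar_curvature g ch) p * g ch p $ i $ k)"


section \<open>Static perfect fluids\<close>

text \<open>Tensor equations on the manifold are expressed by requiring them in every chart.\<close>

definition static_perfect_fluid ::
  "'a topology \<Rightarrow> ('a, 3) chart set \<Rightarrow> ('a, 3) metric
     \<Rightarrow> ('a \<Rightarrow> real) \<Rightarrow> ('a \<Rightarrow> real) \<Rightarrow> ('a \<Rightarrow> real) \<Rightarrow> bool" where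
  "static_perfect_fluid X A g f \<mu> \<rho> \<longleftrightarrow>
     smooth_manifold X A \<and> riemannian_metric A g \<and>
     smooth_function A f \<and> smooth_function A \<mu> \<and> smooth_function A \<rho> \<and>
     (\<forall>p\<in>topspace X. f p > 0) \<and>
     (\<forall>ch\<in>A. \<forall>p\<in>chart_dom ch.
        (\<forall>i j. f p * ricci g ch i j p =
           hessian g ch f i j p + 4 * pi * (\<mu> p - \<rho> p) * f p * g ch p $ i $ j) \<and>
        laplacian g ch f p = 4 * pi * (\<mu> p + 3 * \<rho> p) * f p)"

end

theory Submission
  imports Defs
begin

text \<open>
  Let \<open>H\<close> be the Hessian of \<open>f\<close>, \<open>W = |\<nabla>f|\<^sup>2\<close> and \<open>L = \<Delta>f\<close>. The product rule turns the
  divergence into \<open>(F/f) \<Delta>W\<close> plus terms in \<open>W\<close>, \<open>L\<close> and \<open>\<langle>\<nabla>W, \<nabla>f\<rangle>\<close>, and the Bochner formula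
  (\<open>bochner\<close>) gives \<open>\<Delta>W = 2|H|\<^sup>2 + 2 Ric(\<nabla>f, \<nabla>f) + 2\<langle>\<nabla>L, \<nabla>f\<rangle>\<close>. The Ricci term is a combination of
  \<open>\<langle>\<nabla>W, \<nabla>f\<rangle>\<close> and \<open>W\<close> by the field equation, because \<open>\<nabla>W = 2 H(\<nabla>f)\<close>. The gradient of
  \<open>L = 4\<pi>(\<mu> + 3\<rho>)f\<close> is a multiple of \<open>\<nabla>f\<close> by Euler's equation
  \<open>\<nabla>\<rho> = - f\<^sup>-\<^sup>1 (\<mu> + \<rho>) \<nabla>f\<close> (\<open>pd_pressure\<close>), which is what the contracted Bianchi identity says about a
  metric satisfying the field equation.

  What remains is \<open>|H|\<^sup>2\<close>, and this is where the Cotton tensor enters. Antisymmetrising the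
  derivative of the field equation commutes two covariant derivatives on \<open>\<nabla>f\<close> and so produces
  the curvature tensor applied to \<open>\<nabla>f\<close>. In dimension three the curvature tensor is an algebraic
  expression in the Ricci tensor (\<open>curvature_from_ricci_3d\<close>), hence in \<open>H\<close>. Therefore \<open>f\<^sup>2 C\<close> is
  algebraic in \<open>H\<close> and \<open>\<nabla>f\<close>, and its norm (\<open>cotton_norm_fluid\<close>) is
  \<open>f\<^sup>4 |C|\<^sup>2 = 8 W |H|\<^sup>2 - 3 |\<nabla>W|\<^sup>2 + 4 L \<langle>\<nabla>W, \<nabla>f\<rangle> - 4 L\<^sup>2 W\<close>.

  Solving for \<open>|H|\<^sup>2\<close> leaves \<open>|\<nabla>W|\<^sup>2\<close> with the coefficient \<open>3F/(4fW)\<close>. The weights are chosen to complete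
  it to a square: they satisfy \<open>F'/f + G = 12 F/(1 - f\<^sup>2)\<close> and \<open>G' = 48 f F/(1 - f\<^sup>2)\<^sup>2\<close>
  (\<open>profile_derivatives\<close>), and these are the coefficients of \<open>\<langle>\<nabla>W, \<nabla>f\<rangle>\<close> and \<open>W\<^sup>2\<close> in
  \<open>(3F/(4fW)) |\<nabla>W + 8 f W \<nabla>f/(1 - f\<^sup>2)|\<^sup>2\<close>.

  All identities are between tensor components at a point of one fixed chart. Covariant
  derivatives are moved through traces by \<open>contract_pd_gu\<close>; identities without derivatives are
  verified in a frame that is orthonormal at the point.
\<close>

section \<open>Smooth real functions\<close>

lemma dirderivs_snoc:
  "dirderivs (vs @ [w]) u = dirderivs vs (\<lambda>x. frechet_derivative u (at x) w)"
  by (induction vs) auto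

text \<open>Smoothness refers to iterated derivatives of every order at once, which does not support
  induction for products and reciprocals; counting the order does.\<close>

primrec differentiable_order ::
  "nat \<Rightarrow> 'a::real_normed_vector set \<Rightarrow> ('a \<Rightarrow> real) \<Rightarrow> bool" where
  "differentiable_order 0 S u \<longleftrightarrow> (\<forall>x\<in>S. u differentiable (at x))"
| "differentiable_order (Suc n) S u \<longleftrightarrow> (\<forall>x\<in>S. u differentiable (at x)) \<and>
     (\<forall>w. differentiable_order n S (\<lambda>x. frechet_derivative u (at x) w))"

lemma differentiable_order_iff_dirderivs:
  "differentiable_order n S u \<longleftrightarrow>
     (\<forall>vs. length vs \<le> n \<longrightarrow> (\<forall>x\<in>S. dirderivs vs u differentiable (at x)))"
proof (induction n arbitrary: u)
  case 0
  show ?case by simp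
next
  case (Suc n)
  have "(\<forall>vs. length vs \<le> Suc n \<longrightarrow> P vs) \<longleftrightarrow>
      P [] \<and> (\<forall>w vs. length vs \<le> n \<longrightarrow> P (vs @ [w]))" for P :: "'a list \<Rightarrow> bool"
    by (metis (no_types, lifting) Suc_le_mono append_butlast_last_id length_append_singleton
        list.size(3) zero_le)
  from this[of "\<lambda>vs. \<forall>x\<in>S. dirderivs vs u differentiable (at x)"]
  show ?case by (simp add: Suc.IH dirderivs_snoc)
qed

lemma smooth_on_iff_differentiable_order:
  "smooth_on S u \<longleftrightarrow> (\<forall>n. differentiable_order n S u)"
  unfolding smooth_on_def differentiable_order_iff_dirderivs by auto

lemma differentiable_order_imp_differentiable:
  "differentiable_order n S u \<Longrightarrow> x \<in> S \<Longrightarrow> u differentiable (at x)"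
  by (cases n) auto

lemma differentiable_order_Suc_D:
  "differentiable_order (Suc n) S u \<Longrightarrow> differentiable_order n S u"
  by (auto simp: differentiable_order_iff_dirderivs simp del: differentiable_order.simps)

lemma smooth_on_imp_differentiable:
  "smooth_on S u \<Longrightarrow> x \<in> S \<Longrightarrow> u differentiable (at x)" for u :: "'a::real_normed_vector \<Rightarrow> real"
  unfolding smooth_on_iff_differentiable_order using differentiable_order_imp_differentiable by blast

lemma smooth_on_frechet_derivative:
  fixes u :: "'a::real_normed_vector \<Rightarrow> real"
  assumes "smooth_on S u"
  shows "smooth_on S (\<lambda>x. frechet_derivative u (at x) w)"
  using assms differentiable_order.simps(2) unfolding smooth_on_iff_differentiable_order by blast

lemma differentiable_order_cong:
  assumes "open S" "\<And>x. x \<in> S \<Longrightarrow> u x = v x"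
  shows "differentiable_order n S u \<longleftrightarrow> differentiable_order n S v"
proof -
  have transform: "v differentiable (at x)"
    if "u differentiable (at x)" "x \<in> S" "\<And>x. x \<in> S \<Longrightarrow> u x = v x" for u v :: "'a \<Rightarrow> real" and x
    using that(1) has_derivative_transform_within_open[of u _ x UNIV S v] assms(1) that(2,3)
    unfolding differentiable_def by blast
  have "differentiable_order n S v"
    if "differentiable_order n S u" "\<And>x. x \<in> S \<Longrightarrow> u x = v x" for n u v
    using that
  proof (induction n arbitrary: u v)
    case 0
    then show ?case
      using transform[of u _ v] by simp
  next
    case (Suc n)
    have du: "\<And>x. x \<in> S \<Longrightarrow> u differentiable (at x)"
      using Suc.prems differentiable_order_imp_differentiable by blast
    have "\<And>x. x \<in> S \<Longrightarrow> v differentiable (at x)"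
      using du transform[of u _ v] Suc.prems(2) by blast
    moreover have "frechet_derivative u (at x) w = frechet_derivative v (at x) w" if "x \<in> S" for x w
      using frechet_derivative_transform_within_open[OF du[OF that] assms(1) that] Suc.prems(2) by metis
    ultimately show ?case
      using Suc.prems(1) by (auto intro: Suc.IH[of "\<lambda>x. frechet_derivative u (at x) _"])
  qed
  then show ?thesis using assms(2) by metis
qed

lemma smooth_on_cong:
  fixes u v :: "'a::real_normed_vector \<Rightarrow> real"
  assumes "open S" "\<And>x. x \<in> S \<Longrightarrow> u x = v x"
  shows "smooth_on S u \<longleftrightarrow> smooth_on S v"
  using differentiable_order_cong[of S u v] assms unfolding smooth_on_iff_differentiable_order
  by blast

lemma frechet_derivative_eqI:
  "(u has_derivative u') (at x) \<Longrightarrow> frechet_derivative u (at x) w = u' w"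
  using frechet_derivative_at by metis

lemma smooth_on_const: "smooth_on S (\<lambda>_. k :: real)"
proof -
  have "differentiable_order n S (\<lambda>_. k)" for n
    by (induction n arbitrary: k) auto
  then show ?thesis by (simp add: smooth_on_iff_differentiable_order)
qed

lemma differentiable_order_add:
  assumes "open S"
  shows "differentiable_order n S u \<Longrightarrow> differentiable_order n S v \<Longrightarrow>
    differentiable_order n S (\<lambda>x. u x + v x)"
proof (induction n arbitrary: u v)
  case 0
  then show ?case by simp
next
  case (Suc n)
  have d: "u differentiable (at x)" "v differentiable (at x)" if "x \<in> S" for x
    using Suc.prems that by auto
  have "frechet_derivative (\<lambda>x. u x + v x) (at x) w =
      frechet_derivative u (at x) w + frechet_derivative v (at x) w" if "x \<in> S" for x w
    using d[OF that] unfolding frechet_derivative_works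
    by (intro frechet_derivative_eqI has_derivative_add)
  then have "differentiable_order n S (\<lambda>x. frechet_derivative (\<lambda>x. u x + v x) (at x) w)" for w
    using Suc by (subst differentiable_order_cong[OF assms]) auto
  with d show ?case by simp
qed

lemma differentiable_order_mult:
  assumes "open S"
  shows "differentiable_order n S u \<Longrightarrow> differentiable_order n S v \<Longrightarrow>
    differentiable_order n S (\<lambda>x. u x * v x)"
proof (induction n arbitrary: u v)
  case 0
  then show ?case by simp
next
  case (Suc n)
  have d: "u differentiable (at x)" "v differentiable (at x)" if "x \<in> S" for x
    using Suc.prems that by auto
  have "frechet_derivative (\<lambda>x. u x * v x) (at x) w =
      u x * frechet_derivative v (at x) w + frechet_derivative u (at x) w * v x" if "x \<in> S" for x w
    using d[OF that] unfolding frechet_derivative_works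
    by (intro frechet_derivative_eqI has_derivative_mult)
  then have "differentiable_order n S (\<lambda>x. frechet_derivative (\<lambda>x. u x * v x) (at x) w)" for w
    using Suc differentiable_order_Suc_D[OF Suc.prems(1)] differentiable_order_Suc_D[OF Suc.prems(2)]
    by (subst differentiable_order_cong[OF assms, where v = "\<lambda>x. u x * frechet_derivative v (at x) w +
        frechet_derivative u (at x) w * v x"]) (auto intro: differentiable_order_add[OF assms])
  with d show ?case by simp
qed

text \<open>The derivative of \<open>1/u\<close> is a polynomial in \<open>1/u\<close> and the derivative of \<open>u\<close>, which is
  why the induction on the order needs no information about higher derivatives of \<open>1/u\<close>.\<close>

lemma differentiable_order_inverse:
  assumes "open S" "smooth_on S u" "\<And>x. x \<in> S \<Longrightarrow> u x \<noteq> 0"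
  shows "differentiable_order n S (\<lambda>x. inverse (u x))"
proof (induction n)
  case 0
  then show ?case using assms smooth_on_imp_differentiable by fastforce
next
  case (Suc n)
  have d: "u differentiable (at x)" if "x \<in> S" for x
    using smooth_on_imp_differentiable assms(2) that .
  have "frechet_derivative (\<lambda>x. inverse (u x)) (at x) w =
      (- 1) * (inverse (u x) * frechet_derivative u (at x) w * inverse (u x))" if "x \<in> S" for x w
    using Deriv.has_derivative_inverse[OF assms(3)[OF that] d[OF that, unfolded frechet_derivative_works]]
    by (simp add: frechet_derivative_eqI)
  moreover have "differentiable_order n S
      (\<lambda>x. (- 1) * (inverse (u x) * frechet_derivative u (at x) w * inverse (u x)))" for w
    using smooth_on_frechet_derivative[OF assms(2), of w] smooth_on_const[of S "-1"] Suc
    unfolding smooth_on_iff_differentiable_order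
    by (intro differentiable_order_mult[OF assms(1)]) auto
  ultimately have "differentiable_order n S (\<lambda>x. frechet_derivative (\<lambda>x. inverse (u x)) (at x) w)" for w
    using differentiable_order_cong[OF assms(1)] by (metis (no_types, lifting))
  moreover have "(\<lambda>x. inverse (u x)) differentiable (at x)" if "x \<in> S" for x
    using d[OF that] assms(3)[OF that] by simp
  ultimately show ?case by simp
qed

lemma smooth_on_add:
  fixes u v :: "'a::real_normed_vector \<Rightarrow> real"
  shows "open S \<Longrightarrow> smooth_on S u \<Longrightarrow> smooth_on S v \<Longrightarrow> smooth_on S (\<lambda>x. u x + v x)"
  by (simp add: smooth_on_iff_differentiable_order differentiable_order_add)

lemma smooth_on_mult:
  fixes u v :: "'a::real_normed_vector \<Rightarrow> real"
  shows "open S \<Longrightarrow> smooth_on S u \<Longrightarrow> smooth_on S v \<Longrightarrow> smooth_on S (\<lambda>x. u x * v x)"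
  by (simp add: smooth_on_iff_differentiable_order differentiable_order_mult)

lemma smooth_on_inverse:
  fixes u :: "'a::real_normed_vector \<Rightarrow> real"
  shows "open S \<Longrightarrow> smooth_on S u \<Longrightarrow> (\<And>x. x \<in> S \<Longrightarrow> u x \<noteq> 0) \<Longrightarrow>
    smooth_on S (\<lambda>x. inverse (u x))"
  using differentiable_order_inverse smooth_on_iff_differentiable_order by blast

text \<open>The second difference of \<open>u\<close> over the parallelogram spanned by \<open>s v\<close> and \<open>t w\<close> is, by the
  mean value theorem applied once in each direction, \<open>s t\<close> times a mixed second derivative at
  an intermediate point.\<close>

lemma second_difference_mean_value:
  fixes u :: "'a::real_normed_vector \<Rightarrow> real"
  assumes u: "smooth_on S u" and e: "0 < e"
    and S: "\<And>a b. 0 \<le> a \<Longrightarrow> a \<le> e \<Longrightarrow> 0 \<le> b \<Longrightarrow> b \<le> e \<Longrightarrow> x + a *\<^sub>R v + b *\<^sub>R w \<in> S"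
  obtains a b where "0 < a" "a < e" "0 < b" "b < e"
    "u (x + e *\<^sub>R v + e *\<^sub>R w) - u (x + e *\<^sub>R v) - u (x + e *\<^sub>R w) + u x =
     e * e * frechet_derivative (\<lambda>y. frechet_derivative u (at y) v) (at (x + a *\<^sub>R v + b *\<^sub>R w)) w"
proof -
  have line: "((\<lambda>t. k (y + t *\<^sub>R z)) has_real_derivative frechet_derivative k (at (y + t *\<^sub>R z)) z) (at t)"
    if "k differentiable (at (y + t *\<^sub>R z))" for k :: "'a \<Rightarrow> real" and y z t
  proof -
    have k: "(k has_derivative frechet_derivative k (at (y + t *\<^sub>R z))) (at (y + t *\<^sub>R z))"
      using that frechet_derivative_works by blast
    have "((\<lambda>t. y + t *\<^sub>R z) has_derivative (\<lambda>s. s *\<^sub>R z)) (at t)"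
      by (auto intro!: derivative_eq_intros)
    from has_derivative_compose[OF this k]
    show ?thesis
      unfolding has_field_derivative_def
      by (rule has_derivative_eq_rhs) (simp add: fun_eq_iff linear_scale[OF has_derivative_linear[OF k]])
  qed
  let ?v = "\<lambda>y. frechet_derivative u (at y) v"
  have D1: "((\<lambda>a. u (x + e *\<^sub>R w + a *\<^sub>R v) - u (x + a *\<^sub>R v)) has_real_derivative
      ?v (x + e *\<^sub>R w + a *\<^sub>R v) - ?v (x + a *\<^sub>R v)) (at a)" if "0 \<le> a" "a \<le> e" for a
    using S[of a e] S[of a 0] that e
    by (intro DERIV_diff line smooth_on_imp_differentiable[OF u]) (auto simp: algebra_simps)
  obtain a where a: "0 < a" "a < e" and A:
    "u (x + e *\<^sub>R w + e *\<^sub>R v) - u (x + e *\<^sub>R v) - (u (x + e *\<^sub>R w) - u x) =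
      e * (?v (x + e *\<^sub>R w + a *\<^sub>R v) - ?v (x + a *\<^sub>R v))"
    using MVT2[OF e D1] by auto
  have D2: "((\<lambda>b. ?v (x + a *\<^sub>R v + b *\<^sub>R w)) has_real_derivative
      frechet_derivative ?v (at (x + a *\<^sub>R v + b *\<^sub>R w)) w) (at b)" if "0 \<le> b" "b \<le> e" for b
    using S[of a b] that a
    by (intro line smooth_on_imp_differentiable[OF smooth_on_frechet_derivative[OF u]]) auto
  obtain b where b: "0 < b" "b < e" and B:
    "?v (x + a *\<^sub>R v + e *\<^sub>R w) - ?v (x + a *\<^sub>R v) =
      e * frechet_derivative ?v (at (x + a *\<^sub>R v + b *\<^sub>R w)) w"
    using MVT2[OF e D2] by auto
  show ?thesis
    by (rule that[OF a b]) (use A B in \<open>simp add: algebra_simps\<close>)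
qed

text \<open>Schwarz's theorem: both mixed derivatives are limits of the same second difference
  quotients.\<close>

lemma mixed_derivatives_commute:
  fixes u :: "'a::real_normed_vector \<Rightarrow> real"
  assumes S: "open S" and u: "smooth_on S u" and x: "x \<in> S"
  shows "frechet_derivative (\<lambda>y. frechet_derivative u (at y) v) (at x) w =
         frechet_derivative (\<lambda>y. frechet_derivative u (at y) w) (at x) v"
proof (rule ccontr)
  let ?A = "\<lambda>x. frechet_derivative (\<lambda>y. frechet_derivative u (at y) v) (at x) w"
  let ?B = "\<lambda>x. frechet_derivative (\<lambda>y. frechet_derivative u (at y) w) (at x) v"
  assume ne: "?A x \<noteq> ?B x"
  define \<epsilon> where "\<epsilon> = \<bar>?A x - ?B x\<bar> / 2"
  have "\<epsilon> > 0" using ne by (simp add: \<epsilon>_def)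
  have "isCont ?A x" "isCont ?B x"
    using smooth_on_imp_differentiable[OF smooth_on_frechet_derivative[OF smooth_on_frechet_derivative[OF u]] x]
    by (auto intro: differentiable_imp_continuous_within)
  then obtain d1 d2 where d: "d1 > 0" "d2 > 0"
      "\<And>y. dist y x < d1 \<Longrightarrow> \<bar>?A y - ?A x\<bar> < \<epsilon>" "\<And>y. dist y x < d2 \<Longrightarrow> \<bar>?B y - ?B x\<bar> < \<epsilon>"
    unfolding continuous_at_eps_delta using \<open>\<epsilon> > 0\<close>
    by (metis dist_real_def)
  obtain r where r: "r > 0" "\<And>y. dist y x < r \<Longrightarrow> y \<in> S"
    using S x unfolding open_dist by blast
  define m where "m = min r (min d1 d2)"
  have m: "m > 0" using r d by (simp add: m_def)
  define e where "e = m / (2 * (norm v + norm w + 1))"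
  have e: "e > 0" using m by (simp add: e_def add_nonneg_pos)
  have close: "dist (x + a *\<^sub>R v + b *\<^sub>R w) x < m" if "0 \<le> a" "a \<le> e" "0 \<le> b" "b \<le> e" for a b
  proof -
    have "dist (x + a *\<^sub>R v + b *\<^sub>R w) x \<le> a * norm v + b * norm w"
      using norm_triangle_ineq[of "a *\<^sub>R v" "b *\<^sub>R w"] that by (simp add: dist_norm add.assoc)
    also have "\<dots> \<le> e * norm v + e * norm w"
      using that by (intro add_mono mult_right_mono) auto
    also have "\<dots> < 2 * (e * (norm v + norm w + 1))"
      using e by (simp add: algebra_simps add_nonneg_pos add_pos_nonneg)
    also have "\<dots> = m"
      using add_nonneg_pos[of "norm v + norm w" 1] unfolding e_def
      by (simp del: distrib_left_numeral distrib_right_numeral)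
    finally show ?thesis .
  qed
  have in_S: "x + a *\<^sub>R v + b *\<^sub>R w \<in> S" "x + a *\<^sub>R w + b *\<^sub>R v \<in> S"
    if "0 \<le> a" "a \<le> e" "0 \<le> b" "b \<le> e" for a b
    using close[OF that] close[OF that(3,4,1,2)] r(2) by (auto simp: m_def algebra_simps)
  obtain a b where ab: "0 < a" "a < e" "0 < b" "b < e"
    "u (x + e *\<^sub>R v + e *\<^sub>R w) - u (x + e *\<^sub>R v) - u (x + e *\<^sub>R w) + u x =
     e * e * ?A (x + a *\<^sub>R v + b *\<^sub>R w)"
    by (rule second_difference_mean_value[OF u e in_S(1)])
  obtain a' b' where ab': "0 < a'" "a' < e" "0 < b'" "b' < e"
    "u (x + e *\<^sub>R w + e *\<^sub>R v) - u (x + e *\<^sub>R w) - u (x + e *\<^sub>R v) + u x =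
     e * e * ?B (x + a' *\<^sub>R w + b' *\<^sub>R v)"
    by (rule second_difference_mean_value[OF u e in_S(2)])
  have "e * e * ?A (x + a *\<^sub>R v + b *\<^sub>R w) = e * e * ?B (x + a' *\<^sub>R w + b' *\<^sub>R v)"
    unfolding ab(5)[symmetric] ab'(5)[symmetric] by (simp add: algebra_simps)
  then have "?A (x + a *\<^sub>R v + b *\<^sub>R w) = ?B (x + a' *\<^sub>R w + b' *\<^sub>R v)"
    using e by simp
  moreover have "\<bar>?A (x + a *\<^sub>R v + b *\<^sub>R w) - ?A x\<bar> < \<epsilon>"
    using close[of a b] ab by (intro d) (auto simp: m_def)
  moreover have "\<bar>?B (x + a' *\<^sub>R w + b' *\<^sub>R v) - ?B x\<bar> < \<epsilon>"
    using close[of b' a'] ab' by (intro d) (auto simp: m_def algebra_simps)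
  moreover have False if "k = l" "\<bar>k - p\<bar> < \<bar>p - q\<bar> / 2" "\<bar>l - q\<bar> < \<bar>p - q\<bar> / 2" for k l p q :: real
    using that by (auto simp: abs_if split: if_splits)
  ultimately show False unfolding \<epsilon>_def by blast
qed

section \<open>Partial derivatives in a chart\<close>

locale coordinate_chart =
  fixes ch :: "('a, 'n::finite) chart"
  assumes open_image: "open (chart_image ch)"
    and inj_chart: "inj_on (snd ch) (chart_dom ch)"
begin

definition smooth :: "('a \<Rightarrow> real) \<Rightarrow> bool" where
  "smooth u \<longleftrightarrow> smooth_on (chart_image ch) (u \<circ> chart_inv ch)"

text \<open>Differentiability at a single point is kept apart from smoothness because \<open>F \<circ> f\<close> and
  \<open>G \<circ> f\<close> are differentiable only where \<open>f \<noteq> 1\<close>.\<close>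

definition diff_at :: "('a \<Rightarrow> real) \<Rightarrow> 'a \<Rightarrow> bool" where
  "diff_at u p \<longleftrightarrow> (u \<circ> chart_inv ch) differentiable (at (snd ch p))"

lemma chart_inv_chart [simp]: "p \<in> chart_dom ch \<Longrightarrow> chart_inv ch (snd ch p) = p"
  by (simp add: chart_inv_def inj_chart)

lemma chart_in_image [simp]: "p \<in> chart_dom ch \<Longrightarrow> snd ch p \<in> chart_image ch"
  by (simp add: chart_image_def)

lemma chart_inv_in_dom [simp]: "x \<in> chart_image ch \<Longrightarrow> chart_inv ch x \<in> chart_dom ch"
  by (auto simp: chart_image_def)

lemma chart_chart_inv [simp]: "x \<in> chart_image ch \<Longrightarrow> snd ch (chart_inv ch x) = x"
  by (auto simp: chart_image_def)

lemma smooth_imp_diff_at: "smooth u \<Longrightarrow> p \<in> chart_dom ch \<Longrightarrow> diff_at u p"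
  unfolding smooth_def diff_at_def by (blast intro: smooth_on_imp_differentiable chart_in_image)

lemma smooth_cong:
  "(\<And>q. q \<in> chart_dom ch \<Longrightarrow> u q = v q) \<Longrightarrow> smooth u \<longleftrightarrow> smooth v"
  unfolding smooth_def by (rule smooth_on_cong[OF open_image]) simp

lemma smooth_const: "smooth (\<lambda>_. k)"
  unfolding smooth_def comp_def by (rule smooth_on_const)

lemma smooth_add: "smooth u \<Longrightarrow> smooth v \<Longrightarrow> smooth (\<lambda>q. u q + v q)"
  unfolding smooth_def comp_def by (rule smooth_on_add[OF open_image])

lemma smooth_mult: "smooth u \<Longrightarrow> smooth v \<Longrightarrow> smooth (\<lambda>q. u q * v q)"
  unfolding smooth_def comp_def by (rule smooth_on_mult[OF open_image])

lemma smooth_uminus: "smooth u \<Longrightarrow> smooth (\<lambda>q. - u q)"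
  using smooth_mult[OF smooth_const[of "-1"]] by simp

lemma smooth_diff: "smooth u \<Longrightarrow> smooth v \<Longrightarrow> smooth (\<lambda>q. u q - v q)"
  using smooth_add[OF _ smooth_uminus] by simp

lemma smooth_sum: "(\<And>i. i \<in> I \<Longrightarrow> smooth (u i)) \<Longrightarrow> smooth (\<lambda>q. \<Sum>i\<in>I. u i q)"
  by (induction I rule: infinite_finite_induct) (simp_all add: smooth_const smooth_add)

lemma smooth_prod: "(\<And>i. i \<in> I \<Longrightarrow> smooth (u i)) \<Longrightarrow> smooth (\<lambda>q. \<Prod>i\<in>I. u i q)"
  by (induction I rule: infinite_finite_induct) (simp_all add: smooth_const smooth_mult)

lemma smooth_divide:
  "smooth u \<Longrightarrow> smooth v \<Longrightarrow> (\<And>q. q \<in> chart_dom ch \<Longrightarrow> v q \<noteq> 0) \<Longrightarrow> smooth (\<lambda>q. u q / v q)"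
  unfolding divide_inverse smooth_def comp_def
  by (intro smooth_on_mult[OF open_image] smooth_on_inverse[OF open_image]) simp_all

lemmas smooth_intros =
  smooth_const smooth_add smooth_mult smooth_uminus smooth_diff smooth_sum

lemma smooth_pd: "smooth u \<Longrightarrow> smooth (pd ch i u)"
  unfolding smooth_def
  by (subst smooth_on_cong[OF open_image, where v = "\<lambda>x. frechet_derivative (u \<circ> chart_inv ch) (at x) (axis i 1)"])
    (simp_all add: pd_def smooth_on_frechet_derivative)

lemma pd_commute:
  assumes "smooth u" "p \<in> chart_dom ch"
  shows "pd ch i (pd ch j u) p = pd ch j (pd ch i u) p"
proof -
  let ?D = "\<lambda>i x. frechet_derivative (u \<circ> chart_inv ch) (at x) (axis i 1)"
  have "frechet_derivative (pd ch j u \<circ> chart_inv ch) (at (snd ch p)) =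
      frechet_derivative (?D j) (at (snd ch p))" for j
    using smooth_imp_diff_at[OF smooth_pd[OF assms(1)] assms(2), of j]
    unfolding diff_at_def
    by (rule frechet_derivative_transform_within_open[OF _ open_image])
      (simp_all add: pd_def assms(2))
  then have "pd ch i (pd ch j u) p = frechet_derivative (?D j) (at (snd ch p)) (axis i 1)" for i j
    by (metis pd_def)
  then show ?thesis
    using mixed_derivatives_commute[OF open_image assms(1)[unfolded smooth_def]] assms(2) by simp
qed

text \<open>Identities that hold throughout the chart domain may be differentiated; functions on the
  manifold have arbitrary values outside the domain.\<close>

lemma pd_cong:
  assumes "\<And>q. q \<in> chart_dom ch \<Longrightarrow> u q = v q" "diff_at u p" "p \<in> chart_dom ch"
  shows "pd ch i u p = pd ch i v p"
  unfolding pd_def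
  by (subst frechet_derivative_transform_within_open[OF assms(2)[unfolded diff_at_def] open_image,
        of "v \<circ> chart_inv ch"]) (simp_all add: assms)

lemma diff_atD:
  "diff_at u p \<Longrightarrow> (u \<circ> chart_inv ch has_derivative frechet_derivative (u \<circ> chart_inv ch) (at (snd ch p)))
     (at (snd ch p))"
  unfolding diff_at_def frechet_derivative_works .

lemma diff_at_pdI:
  assumes "(u \<circ> chart_inv ch has_derivative D) (at (snd ch p))"
  shows "diff_at u p" "pd ch i u p = D (axis i 1)"
  using assms frechet_derivative_eqI[OF assms] unfolding diff_at_def differentiable_def pd_def
  by auto

lemma
  shows diff_at_const: "diff_at (\<lambda>_. k) p" and pd_const: "pd ch i (\<lambda>_. k) p = 0"
  by (rule diff_at_pdI[where D = "\<lambda>_. 0"]; simp add: comp_def)+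

lemma
  assumes "diff_at u p" "diff_at v p"
  shows diff_at_add: "diff_at (\<lambda>q. u q + v q) p"
    and pd_add: "pd ch i (\<lambda>q. u q + v q) p = pd ch i u p + pd ch i v p"
  using diff_at_pdI[of "\<lambda>q. u q + v q", unfolded comp_def,
      OF has_derivative_add[OF assms[THEN diff_atD, unfolded comp_def]]]
  by (simp_all add: pd_def comp_def)

lemma
  assumes "diff_at u p" "diff_at v p" "p \<in> chart_dom ch"
  shows diff_at_mult: "diff_at (\<lambda>q. u q * v q) p"
    and pd_mult: "pd ch i (\<lambda>q. u q * v q) p = pd ch i u p * v p + u p * pd ch i v p"
  using diff_at_pdI[of "\<lambda>q. u q * v q", unfolded comp_def,
      OF has_derivative_mult[OF assms(1,2)[THEN diff_atD, unfolded comp_def]]] assms(3)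
  by (simp_all add: pd_def comp_def)

lemma pd_cmult: "diff_at u p \<Longrightarrow> p \<in> chart_dom ch \<Longrightarrow> pd ch i (\<lambda>q. k * u q) p = k * pd ch i u p"
  by (simp add: pd_mult diff_at_const pd_const)

lemma
  assumes "diff_at u p" "p \<in> chart_dom ch"
  shows diff_at_uminus: "diff_at (\<lambda>q. - u q) p"
    and pd_uminus: "pd ch i (\<lambda>q. - u q) p = - pd ch i u p"
  using diff_at_mult[OF diff_at_const[of "-1"] assms] pd_cmult[OF assms, of i "-1"] by simp_all

lemma
  assumes "diff_at u p" "diff_at v p" "p \<in> chart_dom ch"
  shows diff_at_diff: "diff_at (\<lambda>q. u q - v q) p"
    and pd_diff: "pd ch i (\<lambda>q. u q - v q) p = pd ch i u p - pd ch i v p"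
  using diff_at_add[OF assms(1) diff_at_uminus[OF assms(2,3)]]
    pd_add[OF assms(1) diff_at_uminus[OF assms(2,3)], of i] pd_uminus[OF assms(2,3)] by simp_all

lemma
  assumes "\<And>k. k \<in> I \<Longrightarrow> diff_at (u k) p"
  shows diff_at_sum: "diff_at (\<lambda>q. \<Sum>k\<in>I. u k q) p"
    and pd_sum: "pd ch i (\<lambda>q. \<Sum>k\<in>I. u k q) p = (\<Sum>k\<in>I. pd ch i (u k) p)"
proof -
  have "diff_at (\<lambda>q. \<Sum>k\<in>I. u k q) p \<and> pd ch i (\<lambda>q. \<Sum>k\<in>I. u k q) p = (\<Sum>k\<in>I. pd ch i (u k) p)"
    using assms
    by (induction I rule: infinite_finite_induct)
      (simp_all add: diff_at_const pd_const diff_at_add pd_add)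
  then show "diff_at (\<lambda>q. \<Sum>k\<in>I. u k q) p"
    "pd ch i (\<lambda>q. \<Sum>k\<in>I. u k q) p = (\<Sum>k\<in>I. pd ch i (u k) p)" by auto
qed

lemma
  assumes "diff_at u p" "(\<phi> has_real_derivative D) (at (u p))" "p \<in> chart_dom ch"
  shows diff_at_compose: "diff_at (\<lambda>q. \<phi> (u q)) p"
    and pd_compose: "pd ch i (\<lambda>q. \<phi> (u q)) p = D * pd ch i u p"
proof -
  have "(\<phi> has_derivative (\<lambda>t. D * t)) (at (u (chart_inv ch (snd ch p))))"
    using assms(2,3) by (simp add: has_field_derivative_def)
  from diff_at_pdI[of "\<lambda>q. \<phi> (u q)", unfolded comp_def,
      OF has_derivative_compose[OF diff_atD[OF assms(1), unfolded comp_def] this]]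
  show "diff_at (\<lambda>q. \<phi> (u q)) p" "pd ch i (\<lambda>q. \<phi> (u q)) p = D * pd ch i u p"
    by (simp_all add: pd_def comp_def)
qed

lemmas diff_at_intros =
  diff_at_const diff_at_add diff_at_mult diff_at_uminus diff_at_diff diff_at_sum

lemmas pd_simps = pd_const pd_add pd_mult pd_uminus pd_diff pd_sum

end

section \<open>The Levi-Civita connection\<close>

locale metric_chart = coordinate_chart ch
  for ch :: "('a, 'n::finite) chart" +
  fixes g :: "('a, 'n) metric"
  assumes smooth_metric: "\<And>i j. smooth (\<lambda>q. g ch q $ i $ j)"
    and symmetric_metric: "\<And>p. p \<in> chart_dom ch \<Longrightarrow> transpose (g ch p) = g ch p"
    and posdef_metric: "\<And>p v. p \<in> chart_dom ch \<Longrightarrow> v \<noteq> 0 \<Longrightarrow> v \<bullet> (g ch p *v v) > 0"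
begin

text \<open>\<open>gd\<close> and \<open>gu\<close> have their indices down and up, respectively: \<open>g\<^sub>i\<^sub>j\<close> and \<open>g\<^sup>i\<^sup>j\<close>.\<close>

abbreviation gd :: "'n \<Rightarrow> 'n \<Rightarrow> 'a \<Rightarrow> real" where
  "gd i j \<equiv> \<lambda>q. g ch q $ i $ j"

abbreviation gu :: "'n \<Rightarrow> 'n \<Rightarrow> 'a \<Rightarrow> real" where
  "gu i j \<equiv> \<lambda>q. ginv g ch q i j"

abbreviation Gamma :: "'n \<Rightarrow> 'n \<Rightarrow> 'n \<Rightarrow> 'a \<Rightarrow> real" ("\<Gamma>") where
  "\<Gamma> \<equiv> christoffel g ch"

abbreviation Rie :: "'n \<Rightarrow> 'n \<Rightarrow> 'n \<Rightarrow> 'n \<Rightarrow> 'a \<Rightarrow> real" where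
  "Rie \<equiv> riemann g ch"

abbreviation Ric :: "'n \<Rightarrow> 'n \<Rightarrow> 'a \<Rightarrow> real" where
  "Ric \<equiv> ricci g ch"

lemma gd_commute: "p \<in> chart_dom ch \<Longrightarrow> gd i j p = gd j i p"
  using arg_cong[OF symmetric_metric[of p], of "\<lambda>M. M $ i $ j"] by (simp add: transpose_def)

lemma invertible_metric: "p \<in> chart_dom ch \<Longrightarrow> invertible (g ch p)"
  using posdef_metric[of p] unfolding invertible_left_inverse matrix_left_invertible_ker
  by (metis inner_zero_right less_irrefl)

lemma matrix_inv_metric:
  assumes "p \<in> chart_dom ch"
  shows "g ch p ** matrix_inv (g ch p) = mat 1" "matrix_inv (g ch p) ** g ch p = mat 1"
  using someI_ex[OF invertible_metric[OF assms, unfolded invertible_def]]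
  unfolding matrix_inv_def by simp_all

lemma gd_gu: "p \<in> chart_dom ch \<Longrightarrow> (\<Sum>k\<in>UNIV. gd i k p * gu k j p) = (if i = j then 1 else 0)"
  using arg_cong[OF matrix_inv_metric(1), of p "\<lambda>M. M $ i $ j"]
  by (simp add: matrix_matrix_mult_def mat_def ginv_def)

lemma gu_gd: "p \<in> chart_dom ch \<Longrightarrow> (\<Sum>k\<in>UNIV. gu i k p * gd k j p) = (if i = j then 1 else 0)"
  using arg_cong[OF matrix_inv_metric(2), of p "\<lambda>M. M $ i $ j"]
  by (simp add: matrix_matrix_mult_def mat_def ginv_def)

lemma gd_gu_cancel:
  assumes "p \<in> chart_dom ch"
  shows "(\<Sum>k\<in>UNIV. gd i k p * (\<Sum>j\<in>UNIV. gu k j p * x j)) = x i"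
proof -
  have "(\<Sum>k\<in>UNIV. gd i k p * (\<Sum>j\<in>UNIV. gu k j p * x j)) =
      (\<Sum>j\<in>UNIV. (\<Sum>k\<in>UNIV. gd i k p * gu k j p) * x j)"
    unfolding sum_distrib_left sum_distrib_right mult.assoc[symmetric] by (rule sum.swap)
  then show ?thesis by (simp add: gd_gu[OF assms] if_distrib[of "\<lambda>x. x * _"] cong: if_cong)
qed

lemma gu_gd_cancel:
  assumes "p \<in> chart_dom ch"
  shows "(\<Sum>k\<in>UNIV. gu i k p * (\<Sum>j\<in>UNIV. gd k j p * x j)) = x i"
proof -
  have "(\<Sum>k\<in>UNIV. gu i k p * (\<Sum>j\<in>UNIV. gd k j p * x j)) =
      (\<Sum>j\<in>UNIV. (\<Sum>k\<in>UNIV. gu i k p * gd k j p) * x j)"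
    unfolding sum_distrib_left sum_distrib_right mult.assoc[symmetric] by (rule sum.swap)
  then show ?thesis by (simp add: gu_gd[OF assms] if_distrib[of "\<lambda>x. x * _"] cong: if_cong)
qed

lemma gu_commute:
  assumes "p \<in> chart_dom ch"
  shows "gu i j p = gu j i p"
proof -
  have "transpose (matrix_inv (g ch p)) ** g ch p = mat 1"
    using arg_cong[OF matrix_inv_metric(1)[OF assms], of transpose]
    by (simp add: matrix_transpose_mul symmetric_metric[OF assms] transpose_mat)
  then have "transpose (matrix_inv (g ch p)) = matrix_inv (g ch p)"
    using arg_cong[of _ _ "\<lambda>M. M ** matrix_inv (g ch p)"] matrix_inv_metric(1)[OF assms]
    by (metis (no_types) matrix_mul_assoc matrix_mul_lid matrix_mul_rid)
  then have "transpose (matrix_inv (g ch p)) $ j $ i = matrix_inv (g ch p) $ j $ i" by simp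
  then show ?thesis by (simp add: ginv_def transpose_def)
qed

text \<open>Cramer's rule exhibits the entries of the inverse metric as quotients of polynomials in
  the entries of the metric.\<close>

lemma smooth_gu: "smooth (gu i j)"
proof -
  define M where "M q = (\<chi> k l. if l = i then axis j 1 $ k else g ch q $ k $ l)" for q
  have det: "det (g ch p) \<noteq> 0" if "p \<in> chart_dom ch" for p
    using invertible_metric[OF that] by (simp add: invertible_det_nz)
  have "gu i j p = det (M p) / det (g ch p)" if "p \<in> chart_dom ch" for p
  proof -
    have "g ch p *v (\<chi> k. gu k j p) = axis j 1"
      using gd_gu[OF that, of _ j]
      by (simp add: matrix_vector_mult_def vec_eq_iff axis_def)
    then show ?thesis
      using cramer[OF det[OF that], of "\<chi> k. gu k j p" "axis j 1"] by (simp add: M_def vec_eq_iff)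
  qed
  moreover have "smooth (\<lambda>q. det (M q))" "smooth (\<lambda>q. det (g ch q))"
  proof -
    have "smooth (\<lambda>q. M q $ k $ l)" for k l
      by (cases "l = i") (simp_all add: M_def smooth_const smooth_metric)
    then show "smooth (\<lambda>q. det (M q))" "smooth (\<lambda>q. det (g ch q))"
      unfolding det_def by (simp_all add: smooth_intros smooth_prod smooth_metric)
  qed
  ultimately show ?thesis
    using smooth_cong[of "gu i j" "\<lambda>q. det (M q) / det (g ch q)"] smooth_divide det by simp
qed

lemma smooth_christoffel: "smooth (\<Gamma> k i j)"
proof -
  have "\<Gamma> k i j = (\<lambda>q. (\<Sum>l\<in>UNIV. gu k l q *
        (pd ch i (gd j l) q + pd ch j (gd i l) q - pd ch l (gd i j) q)) * (1 / 2))"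
    by (simp add: christoffel_def fun_eq_iff)
  then show ?thesis
    by (simp del: times_divide_eq_right add: smooth_intros smooth_pd smooth_metric smooth_gu)
qed

lemma smooth_riemann: "smooth (Rie l i j k)"
proof -
  have "Rie l i j k = (\<lambda>p. pd ch i (\<Gamma> l j k) p - pd ch j (\<Gamma> l i k) p
     + (\<Sum>m\<in>UNIV. \<Gamma> l i m p * \<Gamma> m j k p - \<Gamma> l j m p * \<Gamma> m i k p))"
    by (simp add: riemann_def fun_eq_iff)
  then show ?thesis
    by (auto intro!: smooth_intros smooth_pd smooth_christoffel)
qed

lemma smooth_ricci: "smooth (Ric j k)"
proof -
  have "Ric j k = (\<lambda>p. \<Sum>i\<in>UNIV. Rie i i j k p)"
    by (simp add: ricci_def fun_eq_iff)
  then show ?thesis by (auto intro!: smooth_intros smooth_riemann)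
qed

lemma smooth_nabla1:
  assumes "\<And>j. smooth (\<alpha> j)" shows "smooth (nabla1 g ch \<alpha> i j)"
proof -
  have "nabla1 g ch \<alpha> i j = (\<lambda>p. pd ch i (\<alpha> j) p - (\<Sum>k\<in>UNIV. \<Gamma> k i j p * \<alpha> k p))"
    by (simp add: nabla1_def fun_eq_iff)
  then show ?thesis by (auto intro!: smooth_intros smooth_christoffel smooth_pd assms)
qed

lemma smooth_hessian: "smooth u \<Longrightarrow> smooth (hessian g ch u i j)"
  unfolding hessian_def by (intro smooth_nabla1 smooth_pd)

lemma smooth_trace2:
  assumes "\<And>i j. smooth (T i j)" shows "smooth (trace2 g ch T)"
proof -
  have "trace2 g ch T = (\<lambda>p. \<Sum>i\<in>UNIV. \<Sum>j\<in>UNIV. gu i j p * T i j p)"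
    by (simp add: trace2_def fun_eq_iff)
  then show ?thesis by (auto intro!: smooth_intros smooth_gu assms)
qed

lemmas smooth_tensors =
  smooth_intros smooth_pd smooth_metric smooth_gu smooth_christoffel smooth_riemann smooth_ricci
  smooth_nabla1 smooth_hessian smooth_trace2

lemmas smooth_tensors_diff_at = smooth_tensors[THEN smooth_imp_diff_at]

lemma pd_gd_commute: "p \<in> chart_dom ch \<Longrightarrow> pd ch m (gd i j) p = pd ch m (gd j i) p"
  by (rule pd_cong) (simp_all add: gd_commute smooth_imp_diff_at smooth_metric)

lemma christoffel_commute: "p \<in> chart_dom ch \<Longrightarrow> \<Gamma> k i j p = \<Gamma> k j i p"
  unfolding christoffel_def by (simp add: pd_gd_commute[of p _ i j] add.commute)

lemma pd_christoffel_commute: "p \<in> chart_dom ch \<Longrightarrow> pd ch m (\<Gamma> k i j) p = pd ch m (\<Gamma> k j i) p"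
  by (rule pd_cong) (simp_all add: christoffel_commute smooth_imp_diff_at smooth_christoffel)

text \<open>The connection is metric: this is \<open>\<nabla>g = 0\<close> solved for the partial derivatives of \<open>g\<close>.\<close>

lemma pd_gd:
  assumes p: "p \<in> chart_dom ch"
  shows "pd ch i (gd j k) p = (\<Sum>s\<in>UNIV. \<Gamma> s i j p * gd s k p) + (\<Sum>s\<in>UNIV. \<Gamma> s i k p * gd s j p)"
proof -
  have lower: "(\<Sum>s\<in>UNIV. \<Gamma> s i j p * gd s k p) =
      (pd ch i (gd j k) p + pd ch j (gd i k) p - pd ch k (gd i j) p) / 2" for i j k
  proof -
    have "(\<Sum>s\<in>UNIV. \<Gamma> s i j p * gd s k p) = (\<Sum>s\<in>UNIV. gd k s p * (\<Sum>l\<in>UNIV. gu s l p *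
        ((pd ch i (gd j l) p + pd ch j (gd i l) p - pd ch l (gd i j) p) / 2)))"
      unfolding christoffel_def sum_divide_distrib
      by (intro sum.cong refl) (simp add: gd_commute[OF p, of _ k] mult.commute)
    then show ?thesis unfolding gd_gu_cancel[OF p] .
  qed
  show ?thesis unfolding lower by (simp add: pd_gd_commute[OF p, of _ k] pd_gd_commute[OF p, of _ j i] field_simps)
qed

text \<open>The same for the inverse metric, obtained by differentiating \<open>g\<^sup>i\<^sup>k g\<^sub>k\<^sub>l = \<delta>\<^sup>i\<^sub>l\<close>.\<close>

lemma pd_gu:
  assumes p: "p \<in> chart_dom ch"
  shows "pd ch m (gu i j) p = - (\<Sum>s\<in>UNIV. \<Gamma> i m s p * gu s j p) - (\<Sum>s\<in>UNIV. \<Gamma> j m s p * gu i s p)"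
proof -
  have zero: "(\<Sum>k\<in>UNIV. pd ch m (gu i k) p * gd k l p) = - (\<Sum>k\<in>UNIV. gu i k p * pd ch m (gd k l) p)" for l
  proof -
    have "pd ch m (\<lambda>q. \<Sum>k\<in>UNIV. gu i k q * gd k l q) p = pd ch m (\<lambda>q. if i = l then 1 else 0) p"
      by (rule pd_cong) (use p in \<open>auto simp: gu_gd intro!: smooth_imp_diff_at smooth_tensors\<close>)
    then show ?thesis
      using p by (simp add: pd_simps diff_at_intros smooth_tensors_diff_at sum.distrib)
  qed
  have "pd ch m (gu i j) p = (\<Sum>l\<in>UNIV. gu j l p * (\<Sum>k\<in>UNIV. gd l k p * pd ch m (gu i k) p))"
    by (simp add: gu_gd_cancel[OF p])
  also have "\<dots> = - (\<Sum>l\<in>UNIV. gu j l p * (\<Sum>k\<in>UNIV. gu i k p * pd ch m (gd k l) p))"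
    using zero by (simp add: gd_commute[OF p, of _ "_::'n"] mult.commute sum_negf)
  also have "(\<Sum>l\<in>UNIV. gu j l p * (\<Sum>k\<in>UNIV. gu i k p * pd ch m (gd k l) p)) =
      (\<Sum>l\<in>UNIV. gu j l p * (\<Sum>k\<in>UNIV. gu i k p * (\<Sum>s\<in>UNIV. gd k s p * \<Gamma> s m l p))) +
      (\<Sum>k\<in>UNIV. gu i k p * (\<Sum>l\<in>UNIV. gu j l p * (\<Sum>s\<in>UNIV. gd l s p * \<Gamma> s m k p)))"
  proof -
    have "(\<Sum>l\<in>UNIV. gu j l p * (\<Sum>k\<in>UNIV. gu i k p * (\<Sum>s\<in>UNIV. gd l s p * \<Gamma> s m k p))) =
      (\<Sum>k\<in>UNIV. gu i k p * (\<Sum>l\<in>UNIV. gu j l p * (\<Sum>s\<in>UNIV. gd l s p * \<Gamma> s m k p)))"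
      by (subst sum_distrib_left, subst sum.swap) (simp add: sum_distrib_left mult.left_commute)
    then show ?thesis
      by (simp add: pd_gd[OF p] distrib_left sum.distrib gd_commute[OF p, of "_::'n"] mult.commute)
  qed
  also have "\<dots> = (\<Sum>l\<in>UNIV. \<Gamma> i m l p * gu l j p) + (\<Sum>k\<in>UNIV. \<Gamma> j m k p * gu i k p)"
    unfolding gu_gd_cancel[OF p] by (simp add: gu_commute[OF p, of j] mult.commute)
  finally show ?thesis by simp
qed


text \<open>Differentiating the inverse metric in a contraction has the effect of minus the
  connection terms of the contracted tensor. This is what lets covariant derivatives commute
  with contractions.\<close>

lemma contract_pd_gu:
  assumes p: "p \<in> chart_dom ch"
  shows "(\<Sum>i\<in>UNIV. \<Sum>j\<in>UNIV. pd ch m (gu i j) p * T i j) =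
    - (\<Sum>i\<in>UNIV. \<Sum>j\<in>UNIV. gu i j p * (\<Sum>l\<in>UNIV. \<Gamma> l m i p * T l j + \<Gamma> l m j p * T i l))"
proof -
  have 1: "(\<Sum>i\<in>UNIV. \<Sum>j\<in>UNIV. \<Sum>s\<in>UNIV. \<Gamma> i m s p * gu s j p * T i j) =
      (\<Sum>i\<in>UNIV. \<Sum>j\<in>UNIV. \<Sum>s\<in>UNIV. gu i j p * (\<Gamma> s m i p * T s j))"
  proof -
    have "(\<Sum>i\<in>UNIV. \<Sum>j\<in>UNIV. \<Sum>s\<in>UNIV. \<Gamma> i m s p * gu s j p * T i j) =
        (\<Sum>j\<in>UNIV. \<Sum>i\<in>UNIV. \<Sum>s\<in>UNIV. \<Gamma> i m s p * gu s j p * T i j)" by (rule sum.swap)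
    also have "\<dots> = (\<Sum>j\<in>UNIV. \<Sum>s\<in>UNIV. \<Sum>i\<in>UNIV. \<Gamma> i m s p * gu s j p * T i j)"
      by (intro sum.cong refl sum.swap)
    also have "\<dots> = (\<Sum>s\<in>UNIV. \<Sum>j\<in>UNIV. \<Sum>i\<in>UNIV. \<Gamma> i m s p * gu s j p * T i j)" by (rule sum.swap)
    finally show ?thesis by (simp add: mult_ac)
  qed
  have 2: "(\<Sum>i\<in>UNIV. \<Sum>j\<in>UNIV. \<Sum>s\<in>UNIV. \<Gamma> j m s p * gu i s p * T i j) =
      (\<Sum>i\<in>UNIV. \<Sum>j\<in>UNIV. \<Sum>s\<in>UNIV. gu i j p * (\<Gamma> s m j p * T i s))"
  proof -
    have "(\<Sum>i\<in>UNIV. \<Sum>j\<in>UNIV. \<Sum>s\<in>UNIV. \<Gamma> j m s p * gu i s p * T i j) =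
        (\<Sum>i\<in>UNIV. \<Sum>s\<in>UNIV. \<Sum>j\<in>UNIV. \<Gamma> j m s p * gu i s p * T i j)"
      by (intro sum.cong refl sum.swap)
    then show ?thesis by (simp add: mult_ac)
  qed
  have "(\<Sum>i\<in>UNIV. \<Sum>j\<in>UNIV. pd ch m (gu i j) p * T i j) =
      - (\<Sum>i\<in>UNIV. \<Sum>j\<in>UNIV. \<Sum>s\<in>UNIV. \<Gamma> i m s p * gu s j p * T i j)
      - (\<Sum>i\<in>UNIV. \<Sum>j\<in>UNIV. \<Sum>s\<in>UNIV. \<Gamma> j m s p * gu i s p * T i j)"
    by (simp add: pd_gu[OF p] left_diff_distrib sum_subtractf sum_distrib_right sum_negf)
  then show ?thesis
    unfolding 1 2 by (simp add: sum.distrib distrib_left sum_distrib_left)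
qed

lemma pd_contract:
  assumes p: "p \<in> chart_dom ch" and T: "\<And>i j. smooth (T i j)"
  shows "pd ch m (\<lambda>q. \<Sum>i\<in>UNIV. \<Sum>j\<in>UNIV. gu i j q * T i j q) p =
    (\<Sum>i\<in>UNIV. \<Sum>j\<in>UNIV. gu i j p * nabla2 g ch T m i j p)"
proof -
  have "pd ch m (\<lambda>q. \<Sum>i\<in>UNIV. \<Sum>j\<in>UNIV. gu i j q * T i j q) p =
      (\<Sum>i\<in>UNIV. \<Sum>j\<in>UNIV. pd ch m (gu i j) p * T i j p) +
      (\<Sum>i\<in>UNIV. \<Sum>j\<in>UNIV. gu i j p * pd ch m (T i j) p)"
    using p T by (simp add: pd_simps diff_at_intros smooth_tensors_diff_at smooth_imp_diff_at sum.distrib)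
  then show ?thesis
    unfolding contract_pd_gu[OF p]
    by (simp add: nabla2_def right_diff_distrib sum_subtractf)
qed

lemma pd_trace2:
  assumes "p \<in> chart_dom ch" and "\<And>i j. smooth (T i j)"
  shows "pd ch m (trace2 g ch T) p = (\<Sum>i\<in>UNIV. \<Sum>j\<in>UNIV. gu i j p * nabla2 g ch T m i j p)"
  using pd_contract[OF assms] by (simp add: trace2_def[abs_def])

lemma nabla2_tensor_product:
  assumes "p \<in> chart_dom ch" "\<And>j. smooth (\<alpha> j)" "\<And>j. smooth (\<beta> j)"
  shows "nabla2 g ch (\<lambda>j k q. \<alpha> j q * \<beta> k q) i j k p =
    nabla1 g ch \<alpha> i j p * \<beta> k p + \<alpha> j p * nabla1 g ch \<beta> i k p"
  using assms
  by (simp add: nabla2_def nabla1_def pd_simps smooth_imp_diff_at algebra_simps sum.distrib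
      sum_distrib_left)

text \<open>The instance \<open>T = \<nabla>\<^sup>2u\<close>, \<open>\<beta> = du\<close> gives half the Hessian of \<open>|\<nabla>u|\<^sup>2\<close>.\<close>

lemma nabla1_contract:
  assumes p: "p \<in> chart_dom ch" and T: "\<And>i j. smooth (T i j)" and \<beta>: "\<And>j. smooth (\<beta> j)"
  shows "nabla1 g ch (\<lambda>b q. \<Sum>i\<in>UNIV. \<Sum>j\<in>UNIV. gu i j q * (T b i q * \<beta> j q)) a b p =
    (\<Sum>i\<in>UNIV. \<Sum>j\<in>UNIV. gu i j p * (nabla2 g ch T a b i p * \<beta> j p + T b i p * nabla1 g ch \<beta> a j p))"
proof -
  have "(\<Sum>k\<in>UNIV. \<Gamma> k a b p * (\<Sum>i\<in>UNIV. \<Sum>j\<in>UNIV. gu i j p * (T k i p * \<beta> j p))) =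
      (\<Sum>i\<in>UNIV. \<Sum>k\<in>UNIV. \<Gamma> k a b p * (\<Sum>j\<in>UNIV. gu i j p * (T k i p * \<beta> j p)))"
    unfolding sum_distrib_left by (rule sum.swap)
  also have "\<dots> = (\<Sum>i\<in>UNIV. \<Sum>j\<in>UNIV. \<Sum>k\<in>UNIV. \<Gamma> k a b p * (gu i j p * (T k i p * \<beta> j p)))"
    unfolding sum_distrib_left by (intro sum.cong refl sum.swap)
  finally have swap: "(\<Sum>k\<in>UNIV. \<Gamma> k a b p * (\<Sum>i\<in>UNIV. \<Sum>j\<in>UNIV. gu i j p * (T k i p * \<beta> j p))) =
      (\<Sum>i\<in>UNIV. \<Sum>j\<in>UNIV. gu i j p * (\<Sum>k\<in>UNIV. \<Gamma> k a b p * (T k i p * \<beta> j p)))"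
    by (simp add: sum_distrib_left mult.left_commute)
  have "nabla2 g ch T a b i p * \<beta> j p + T b i p * nabla1 g ch \<beta> a j p =
      nabla2 g ch (\<lambda>i j q. T b i q * \<beta> j q) a i j p -
      (\<Sum>k\<in>UNIV. \<Gamma> k a b p * (T k i p * \<beta> j p))" for i j
    using p T \<beta> by (simp add: nabla2_def nabla1_def pd_simps smooth_imp_diff_at algebra_simps sum.distrib
      sum_distrib_left)
  then show ?thesis
    using p T \<beta>
    by (simp add: nabla1_def[of _ _ "\<lambda>b q. \<Sum>i\<in>UNIV. \<Sum>j\<in>UNIV. gu i j q * (T b i q * \<beta> j q)"]
        pd_contract smooth_mult swap right_diff_distrib sum_subtractf)
qed

lemma hessian_commute:
  "smooth u \<Longrightarrow> p \<in> chart_dom ch \<Longrightarrow> hessian g ch u i j p = hessian g ch u j i p"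
  by (simp add: hessian_def nabla1_def pd_commute[of u p i j] christoffel_commute[of p _ i j])

lemma nabla2_cong:
  assumes "\<And>j k q. q \<in> chart_dom ch \<Longrightarrow> S j k q = T j k q" "\<And>j k. smooth (S j k)" "p \<in> chart_dom ch"
  shows "nabla2 g ch S i j k p = nabla2 g ch T i j k p"
  using assms by (simp add: nabla2_def pd_cong[of "S j k" "T j k"] smooth_imp_diff_at)

text \<open>The covariant derivative of a symmetric tensor is symmetric in the last two indices.\<close>

lemma nabla2_swap_cong:
  assumes "\<And>j k q. q \<in> chart_dom ch \<Longrightarrow> T j k q = T k j q" "\<And>j k. smooth (T j k)" "p \<in> chart_dom ch"
  shows "nabla2 g ch T i j k p = nabla2 g ch T i k j p"
proof -
  have "nabla2 g ch T i j k p = nabla2 g ch (\<lambda>j k. T k j) i j k p"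
    using assms by (intro nabla2_cong) auto
  then show ?thesis by (simp add: nabla2_def add.commute)
qed

section \<open>Curvature\<close>

text \<open>The connection terms of first order in \<open>\<alpha>\<close> are symmetric in \<open>i\<close> and \<open>j\<close> because the connection
  has no torsion, so that only the curvature survives the antisymmetrisation.\<close>

lemma ricci_identity:
  assumes p: "p \<in> chart_dom ch" and \<alpha>: "\<And>j. smooth (\<alpha> j)"
  shows "nabla2 g ch (nabla1 g ch \<alpha>) i j k p - nabla2 g ch (nabla1 g ch \<alpha>) j i k p =
    - (\<Sum>l\<in>UNIV. Rie l i j k p * \<alpha> l p)"
proof -
  have dd: "pd ch i (nabla1 g ch \<alpha> j k) p = pd ch i (pd ch j (\<alpha> k)) p
      - (\<Sum>s\<in>UNIV. pd ch i (\<Gamma> s j k) p * \<alpha> s p) - (\<Sum>s\<in>UNIV. \<Gamma> s j k p * pd ch i (\<alpha> s) p)" for i j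
    unfolding nabla1_def[abs_def]
    using p \<alpha> by (simp add: pd_simps diff_at_intros smooth_tensors_diff_at smooth_imp_diff_at sum.distrib)
  have swap: "(\<Sum>l\<in>UNIV. \<Gamma> l i k p * (\<Sum>s\<in>UNIV. \<Gamma> s j l p * \<alpha> s p)) =
      (\<Sum>l\<in>UNIV. (\<Sum>m\<in>UNIV. \<Gamma> l j m p * \<Gamma> m i k p) * \<alpha> l p)" for i j
    unfolding sum_distrib_left sum_distrib_right by (subst sum.swap) (simp add: mult_ac)
  have "nabla2 g ch (nabla1 g ch \<alpha>) i j k p = pd ch i (pd ch j (\<alpha> k)) p
      - (\<Sum>s\<in>UNIV. pd ch i (\<Gamma> s j k) p * \<alpha> s p)
      - ((\<Sum>s\<in>UNIV. \<Gamma> s j k p * pd ch i (\<alpha> s) p) + (\<Sum>s\<in>UNIV. \<Gamma> s i k p * pd ch j (\<alpha> s) p))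
      - (\<Sum>l\<in>UNIV. \<Gamma> l i j p * nabla1 g ch \<alpha> l k p)
      + (\<Sum>l\<in>UNIV. (\<Sum>m\<in>UNIV. \<Gamma> l j m p * \<Gamma> m i k p) * \<alpha> l p)" for i j
    unfolding swap[symmetric] nabla2_def dd
    by (simp add: nabla1_def[of _ _ _ j] sum.distrib right_diff_distrib sum_subtractf)
  then show ?thesis
    using p \<alpha>
    by (simp add: riemann_def pd_commute[of "\<alpha> k" p i j] christoffel_commute[of p _ i j]
        sum.distrib left_diff_distrib distrib_right sum_subtractf)
qed

lemma riemann_antisym: "Rie l i j k p = - Rie l j i k p"
  by (simp add: riemann_def sum_subtractf)

lemma first_bianchi:
  assumes p: "p \<in> chart_dom ch"
  shows "Rie l i j k p + Rie l j k i p + Rie l k i j p = 0"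
  unfolding riemann_def
  by (simp add: sum_subtractf christoffel_commute[OF p, of _ k j] christoffel_commute[OF p, of _ k i]
      christoffel_commute[OF p, of _ j i] pd_christoffel_commute[OF p, of _ _ k j]
      pd_christoffel_commute[OF p, of _ _ k i] pd_christoffel_commute[OF p, of _ _ j i])

text \<open>The curvature tensor with its upper index lowered to the first place, that is
  \<open>\<langle>R(\<partial>\<^sub>i, \<partial>\<^sub>j)\<partial>\<^sub>k, \<partial>\<^sub>l\<rangle>\<close>.\<close>

definition Rlow :: "'n \<Rightarrow> 'n \<Rightarrow> 'n \<Rightarrow> 'n \<Rightarrow> 'a \<Rightarrow> real" where
  "Rlow l i j k p = (\<Sum>s\<in>UNIV. gd s l p * Rie s i j k p)"

text \<open>Because the connection is metric, the curvature acts on the metric as zero; that is, the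
  commutator of the second derivatives of \<open>g\<^sub>k\<^sub>l\<close> is the symmetrised lowered curvature.\<close>

lemma Rlow_antisym_outer:
  assumes p: "p \<in> chart_dom ch"
  shows "Rlow l i j k p = - Rlow k i j l p"
proof -
  define A where "A i j k l = (\<Sum>s\<in>UNIV. pd ch i (\<Gamma> s j k) p * gd s l p)" for i j k l
  define B where "B i j k l = (\<Sum>s\<in>UNIV. \<Gamma> s j k p * (\<Sum>t\<in>UNIV. \<Gamma> t i s p * gd t l p))" for i j k l
  define C where "C i j k l = (\<Sum>s\<in>UNIV. \<Gamma> s j k p * (\<Sum>t\<in>UNIV. \<Gamma> t i l p * gd t s p))" for i j k l
  have C: "C i j k l = C j i l k" for i j k l
    unfolding C_def sum_distrib_left
    by (subst sum.swap) (simp add: gd_commute[OF p, of _ "_::'n"] mult_ac)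
  have dd: "pd ch i (pd ch j (gd k l)) p =
      A i j k l + A i j l k + B i j k l + B i j l k + C i j k l + C i j l k" for i j k l
  proof -
    have "pd ch i (pd ch j (gd k l)) p =
        pd ch i (\<lambda>q. (\<Sum>s\<in>UNIV. \<Gamma> s j k q * gd s l q) + (\<Sum>s\<in>UNIV. \<Gamma> s j l q * gd s k q)) p"
      by (rule pd_cong) (use p in \<open>simp_all add: pd_gd smooth_imp_diff_at smooth_pd smooth_metric\<close>)
    also have "\<dots> = (\<Sum>s\<in>UNIV. pd ch i (\<Gamma> s j k) p * gd s l p) + (\<Sum>s\<in>UNIV. \<Gamma> s j k p * pd ch i (gd s l) p)
       + ((\<Sum>s\<in>UNIV. pd ch i (\<Gamma> s j l) p * gd s k p) + (\<Sum>s\<in>UNIV. \<Gamma> s j l p * pd ch i (gd s k) p))"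
      using p by (simp add: pd_simps diff_at_intros smooth_tensors_diff_at sum.distrib)
    finally show ?thesis
      unfolding pd_gd[OF p] A_def B_def C_def by (simp add: distrib_left sum.distrib)
  qed
  have R: "Rlow l i j k p = A i j k l - A j i k l + B i j k l - B j i k l" for i j k l
  proof -
    have "B i j k l = (\<Sum>t\<in>UNIV. gd t l p * (\<Sum>m\<in>UNIV. \<Gamma> t i m p * \<Gamma> m j k p))" for i j
      unfolding B_def sum_distrib_left by (subst sum.swap) (simp add: mult_ac)
    then show ?thesis
      unfolding Rlow_def riemann_def A_def
      by (simp add: algebra_simps sum.distrib sum_subtractf)
  qed
  show ?thesis
    using pd_commute[OF smooth_metric p, of i j k l] C[of i j k l] C[of i j l k]
    unfolding R dd by simp
qed

lemma Rlow_antisym: "Rlow l i j k p = - Rlow l j i k p"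
  by (simp add: Rlow_def riemann_antisym[of _ i j] sum_negf)

text \<open>Add and subtract the first Bianchi identity with each of the four indices left out of the
  cyclic permutation.\<close>

lemma Rlow_pair_symmetric:
  assumes p: "p \<in> chart_dom ch"
  shows "Rlow l i j k p = Rlow j k l i p"
proof -
  have b: "Rlow l i j k p + Rlow l j k i p + Rlow l k i j p = 0" for l i j k
    using first_bianchi[OF p, of _ i j k]
    by (simp add: Rlow_def sum.distrib[symmetric] distrib_left[symmetric])
  note a = Rlow_antisym[of _ _ _ _ p]
  note c = Rlow_antisym_outer[OF p]
  have "Rlow l i j k p + Rlow l j k i p + Rlow l k i j p = 0" by (rule b)
  moreover have "Rlow l i j k p + Rlow i j l k p + Rlow k i l j p = 0"
    using b[of k i j l] c[of k i j l] c[of k j l i] a[of k i l j] by linarith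
  moreover have "Rlow l j k i p + Rlow j k l i p + Rlow i j l k p = 0"
    using b[of i j k l] c[of i j k l] c[of i k l j] a[of i j l k] by linarith
  moreover have "Rlow l k i j p + Rlow j k l i p + Rlow k i l j p = 0"
    using b[of j i k l] c[of l k i j] a[of j i k l] a[of j l i k] c[of j i l k] by linarith
  ultimately show ?thesis by linarith
qed


text \<open>The covariant derivative \<open>\<nabla>\<^sub>m R\<^sup>l\<^sub>i\<^sub>j\<^sub>k\<close> of the curvature tensor.\<close>

definition nablaR :: "'n \<Rightarrow> 'n \<Rightarrow> 'n \<Rightarrow> 'n \<Rightarrow> 'n \<Rightarrow> 'a \<Rightarrow> real" where
  "nablaR m l i j k p = pd ch m (Rie l i j k) p
     + (\<Sum>s\<in>UNIV. \<Gamma> l m s p * Rie s i j k p) - (\<Sum>s\<in>UNIV. \<Gamma> s m k p * Rie l i j s p)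
     - (\<Sum>s\<in>UNIV. \<Gamma> s m i p * Rie l s j k p) - (\<Sum>s\<in>UNIV. \<Gamma> s m j p * Rie l i s k p)"

text \<open>The connection terms on the indices \<open>m\<close>, \<open>i\<close>, \<open>j\<close> cancel in the cyclic sum because the
  connection is symmetric and the curvature antisymmetric. The others form the Jacobi identity of
  the operators \<open>\<partial>\<^sub>a + \<Gamma>\<^sub>a\<close>; it is checked by sorting the sums by the number of derivatives
  of Christoffel symbols (the second derivatives, \<open>U\<close> and \<open>V\<close>, and \<open>P\<close>).\<close>

lemma second_bianchi:
  assumes p: "p \<in> chart_dom ch"
  shows "nablaR m l i j k p + nablaR i l j m k p + nablaR j l m i k p = 0"
proof -
  define P where "P a b c = (\<Sum>s\<in>UNIV. \<Gamma> l a s p * (\<Sum>t\<in>UNIV. \<Gamma> s b t p * \<Gamma> t c k p))" for a b c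
  define U where "U a b c = (\<Sum>s\<in>UNIV. pd ch a (\<Gamma> l b s) p * \<Gamma> s c k p)" for a b c
  define V where "V a b c = (\<Sum>s\<in>UNIV. \<Gamma> l a s p * pd ch b (\<Gamma> s c k) p)" for a b c
  define Q where "Q a b c = (\<Sum>s\<in>UNIV. \<Gamma> s a b p * Rie l s c k p)" for a b c
  have Q: "(\<Sum>s\<in>UNIV. \<Gamma> s a b p * Rie l c s k p) = - Q a b c" for a b c
    by (simp add: Q_def riemann_antisym[of l c] sum_negf)
  have Q_commute: "Q a b c = Q b a c" for a b c
    by (simp add: Q_def christoffel_commute[OF p, of _ a b])
  have P: "(\<Sum>s\<in>UNIV. \<Gamma> s c k p * (\<Sum>t\<in>UNIV. \<Gamma> l a t p * \<Gamma> t b s p)) = P a b c" for a b c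
    unfolding P_def sum_distrib_left by (subst sum.swap) (simp add: mult_ac)
  have upper: "(\<Sum>s\<in>UNIV. \<Gamma> l a s p * Rie s b c k p) = V a b c - V a c b + P a b c - P a c b" for a b c
    unfolding riemann_def V_def P_def
    by (simp add: algebra_simps sum.distrib sum_subtractf)
  have lower: "(\<Sum>s\<in>UNIV. \<Gamma> s a k p * Rie l b c s p) = U b c a - U c b a + P b c a - P c b a" for a b c
    unfolding riemann_def U_def P[symmetric]
    by (simp add: algebra_simps sum.distrib sum_subtractf)
  have pd_R: "pd ch a (Rie l b c k) p = pd ch a (pd ch b (\<Gamma> l c k)) p - pd ch a (pd ch c (\<Gamma> l b k)) p
      + U a b c + V b a c - U a c b - V c a b" for a b c
    unfolding riemann_def[abs_def] U_def V_def
    using p by (simp add: pd_simps diff_at_intros smooth_tensors_diff_at smooth_imp_diff_at smooth_pd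
        smooth_christoffel sum.distrib sum_subtractf)
  have comm: "pd ch a (pd ch b (\<Gamma> l c k)) p = pd ch b (pd ch a (\<Gamma> l c k)) p" for a b c
    by (rule pd_commute[OF smooth_christoffel p])
  show ?thesis
    unfolding nablaR_def upper lower pd_R Q Q_def[symmetric]
    using comm[of m i j] comm[of m j i] comm[of i j m]
      Q_commute[of m i j] Q_commute[of m j i] Q_commute[of i j m]
    by simp
qed

lemma nablaR_antisym:
  assumes p: "p \<in> chart_dom ch"
  shows "nablaR m l i j k p = - nablaR m l j i k p"
proof -
  have "pd ch m (Rie l i j k) p = pd ch m (\<lambda>q. - Rie l j i k q) p"
    by (rule pd_cong[OF riemann_antisym _ p]) (simp add: p smooth_tensors_diff_at)
  also have "\<dots> = - pd ch m (Rie l j i k) p"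
    using p by (simp add: pd_uminus smooth_tensors_diff_at)
  finally have "pd ch m (Rie l i j k) p = - pd ch m (Rie l j i k) p" .
  moreover have "(\<Sum>s\<in>UNIV. x s * Rie (y s) i j (z s) p) = - (\<Sum>s\<in>UNIV. x s * Rie (y s) j i (z s) p)" for x y z
    by (simp add: riemann_antisym[of _ i j] sum_negf)
  note this[of "\<lambda>s. \<Gamma> l m s p" "\<lambda>s. s" "\<lambda>_. k"] this[of "\<lambda>s. \<Gamma> s m k p" "\<lambda>_. l" "\<lambda>s. s"]
  moreover have "(\<Sum>s\<in>UNIV. x s * Rie l s c k p) = - (\<Sum>s\<in>UNIV. x s * Rie l c s k p)" for x c
    by (simp add: riemann_antisym[of _ _ c] sum_negf)
  ultimately show ?thesis
    unfolding nablaR_def by simp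
qed

lemma nablaR_trace:
  assumes p: "p \<in> chart_dom ch"
  shows "(\<Sum>l\<in>UNIV. nablaR m l l j k p) = nabla2 g ch Ric m j k p"
proof -
  have "(\<Sum>l\<in>UNIV. \<Sum>s\<in>UNIV. \<Gamma> l m s p * Rie s l j k p) = (\<Sum>l\<in>UNIV. \<Sum>s\<in>UNIV. \<Gamma> s m l p * Rie l s j k p)"
    by (rule sum.swap)
  moreover have "(\<Sum>l\<in>UNIV. \<Sum>s\<in>UNIV. \<Gamma> s m k p * Rie l l j s p) = (\<Sum>s\<in>UNIV. \<Gamma> s m k p * Ric j s p)"
    unfolding ricci_def sum_distrib_left by (rule sum.swap)
  moreover have "(\<Sum>l\<in>UNIV. \<Sum>s\<in>UNIV. \<Gamma> s m j p * Rie l l s k p) = (\<Sum>s\<in>UNIV. \<Gamma> s m j p * Ric s k p)"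
    unfolding ricci_def sum_distrib_left by (rule sum.swap)
  moreover have "pd ch m (Ric j k) p = (\<Sum>l\<in>UNIV. pd ch m (Rie l l j k) p)"
    unfolding ricci_def[abs_def] using p by (simp add: pd_sum smooth_tensors_diff_at)
  ultimately show ?thesis
    by (simp add: nablaR_def nabla2_def sum.distrib sum_subtractf)
qed

lemma riemann_eq_raise_Rlow:
  "p \<in> chart_dom ch \<Longrightarrow> Rie l i j k p = (\<Sum>t\<in>UNIV. gu l t p * Rlow t i j k p)"
  unfolding Rlow_def by (simp add: gd_commute[of p _ "_::'n"] gu_gd_cancel)

lemma ricci_eq_contract_Rlow:
  "p \<in> chart_dom ch \<Longrightarrow> Ric j k p = (\<Sum>a\<in>UNIV. \<Sum>b\<in>UNIV. gu a b p * Rlow b a j k p)"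
  unfolding ricci_def by (simp add: riemann_eq_raise_Rlow)

lemma ricci_commute:
  assumes p: "p \<in> chart_dom ch"
  shows "Ric j k p = Ric k j p"
proof -
  have "Rlow b a j k p = Rlow a b k j p" for a b
    using Rlow_pair_symmetric[OF p, of b a j k] Rlow_antisym_outer[OF p, of j k b a]
      Rlow_antisym[of a k b j p] by simp
  then have "Ric j k p = (\<Sum>a\<in>UNIV. \<Sum>b\<in>UNIV. gu b a p * Rlow a b k j p)"
    by (simp add: ricci_eq_contract_Rlow[OF p] gu_commute[OF p, of _ "_::'n"])
  also have "\<dots> = Ric k j p"
    unfolding ricci_eq_contract_Rlow[OF p] by (rule sum.swap)
  finally show ?thesis .
qed

text \<open>By the symmetries of \<open>Rlow\<close> this trace of the curvature is again the Ricci tensor, now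
  with one index raised.\<close>

lemma contract_riemann_last:
  assumes p: "p \<in> chart_dom ch"
  shows "(\<Sum>j\<in>UNIV. \<Sum>k\<in>UNIV. gu j k p * Rie l i j k p) = (\<Sum>t\<in>UNIV. gu l t p * Ric t i p)"
proof -
  have R: "Rlow t i j k p = Rlow k j i t p" for t j k
    using Rlow_antisym_outer[OF p, of t i j k] Rlow_antisym[of k i j t p] by simp
  have "(\<Sum>j\<in>UNIV. \<Sum>k\<in>UNIV. gu j k p * Rie l i j k p) =
      (\<Sum>j\<in>UNIV. \<Sum>k\<in>UNIV. \<Sum>t\<in>UNIV. gu l t p * (gu j k p * Rlow k j i t p))"
    unfolding riemann_eq_raise_Rlow[OF p] sum_distrib_left R by (simp add: mult.left_commute)
  also have "\<dots> = (\<Sum>j\<in>UNIV. \<Sum>t\<in>UNIV. \<Sum>k\<in>UNIV. gu l t p * (gu j k p * Rlow k j i t p))"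
    by (intro sum.cong refl sum.swap)
  also have "\<dots> = (\<Sum>t\<in>UNIV. gu l t p * (\<Sum>j\<in>UNIV. \<Sum>k\<in>UNIV. gu j k p * Rlow k j i t p))"
    unfolding sum_distrib_left by (rule sum.swap)
  also have "\<dots> = (\<Sum>t\<in>UNIV. gu l t p * Ric t i p)"
    by (simp add: ricci_eq_contract_Rlow[OF p, symmetric] ricci_commute[OF p, of i])
  finally show ?thesis .
qed

text \<open>The covariant derivative of the preceding identity.\<close>

lemma contract_nablaR_last:
  assumes p: "p \<in> chart_dom ch"
  shows "(\<Sum>j\<in>UNIV. \<Sum>k\<in>UNIV. gu j k p * nablaR m l i j k p) =
    (\<Sum>t\<in>UNIV. gu l t p * nabla2 g ch Ric m t i p)"
proof -
  define V where "V l i q = (\<Sum>j\<in>UNIV. \<Sum>k\<in>UNIV. gu j k q * Rie l i j k q)" for l i q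
  have V: "V l i q = (\<Sum>t\<in>UNIV. gu l t q * Ric t i q)" if "q \<in> chart_dom ch" for l i q
    unfolding V_def by (rule contract_riemann_last[OF that])
  have pull: "(\<Sum>j\<in>UNIV. \<Sum>k\<in>UNIV. gu j k p * (\<Sum>s\<in>UNIV. x s * y s j k)) =
      (\<Sum>s\<in>UNIV. x s * (\<Sum>j\<in>UNIV. \<Sum>k\<in>UNIV. gu j k p * y s j k))" for x y
  proof -
    have "(\<Sum>j\<in>UNIV. \<Sum>k\<in>UNIV. gu j k p * (\<Sum>s\<in>UNIV. x s * y s j k)) =
        (\<Sum>j\<in>UNIV. \<Sum>s\<in>UNIV. \<Sum>k\<in>UNIV. x s * (gu j k p * y s j k))"
      unfolding sum_distrib_left by (simp add: mult.left_commute, intro sum.cong refl sum.swap)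
    also have "\<dots> = (\<Sum>s\<in>UNIV. \<Sum>j\<in>UNIV. \<Sum>k\<in>UNIV. x s * (gu j k p * y s j k))"
      by (rule sum.swap)
    finally show ?thesis by (simp add: sum_distrib_left)
  qed
  have "nablaR m l i j k p = nabla2 g ch (Rie l i) m j k p
      + (\<Sum>s\<in>UNIV. \<Gamma> l m s p * Rie s i j k p) - (\<Sum>s\<in>UNIV. \<Gamma> s m i p * Rie l s j k p)" for j k
    by (simp add: nablaR_def nabla2_def sum.distrib)
  then have "(\<Sum>j\<in>UNIV. \<Sum>k\<in>UNIV. gu j k p * nablaR m l i j k p) =
      pd ch m (V l i) p + (\<Sum>s\<in>UNIV. \<Gamma> l m s p * V s i p) - (\<Sum>s\<in>UNIV. \<Gamma> s m i p * V l s p)"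
    unfolding V_def using p
    by (simp add: pd_contract smooth_riemann distrib_left right_diff_distrib sum.distrib sum_subtractf pull)
  also have "pd ch m (V l i) p = pd ch m (\<lambda>q. \<Sum>t\<in>UNIV. gu l t q * Ric t i q) p"
    by (rule pd_cong[OF V _ p])
      (use p in \<open>simp_all add: V_def[abs_def] smooth_imp_diff_at smooth_sum smooth_mult smooth_gu smooth_riemann\<close>)
  also have "\<dots> = (\<Sum>t\<in>UNIV. pd ch m (gu l t) p * Ric t i p) + (\<Sum>t\<in>UNIV. gu l t p * pd ch m (Ric t i) p)"
    using p by (simp add: pd_simps diff_at_intros smooth_tensors_diff_at sum.distrib)
  also have "(\<Sum>t\<in>UNIV. pd ch m (gu l t) p * Ric t i p) =
      - (\<Sum>s\<in>UNIV. \<Gamma> l m s p * V s i p) - (\<Sum>t\<in>UNIV. gu l t p * (\<Sum>s\<in>UNIV. \<Gamma> s m t p * Ric s i p))"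
  proof -
    have "(\<Sum>t\<in>UNIV. (\<Sum>s\<in>UNIV. \<Gamma> l m s p * gu s t p) * Ric t i p) = (\<Sum>s\<in>UNIV. \<Gamma> l m s p * V s i p)"
      unfolding V[OF p] sum_distrib_left sum_distrib_right by (subst sum.swap) (simp add: mult_ac)
    moreover have "(\<Sum>t\<in>UNIV. (\<Sum>s\<in>UNIV. \<Gamma> t m s p * gu l s p) * Ric t i p) =
        (\<Sum>t\<in>UNIV. gu l t p * (\<Sum>s\<in>UNIV. \<Gamma> s m t p * Ric s i p))"
      unfolding sum_distrib_left sum_distrib_right by (subst sum.swap) (simp add: mult_ac)
    ultimately show ?thesis
      by (simp add: pd_gu[OF p] left_diff_distrib sum_subtractf sum_negf)
  qed
  also have "(\<Sum>s\<in>UNIV. \<Gamma> s m i p * V l s p) = (\<Sum>t\<in>UNIV. gu l t p * (\<Sum>s\<in>UNIV. \<Gamma> s m i p * Ric t s p))"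
    unfolding V[OF p] sum_distrib_left by (subst sum.swap) (simp add: mult_ac)
  finally show ?thesis
    by (simp add: nabla2_def sum.distrib right_diff_distrib distrib_left sum_subtractf)
qed

text \<open>Contracting the second Bianchi identity over \<open>l = m\<close> gives the antisymmetrised derivative of
  the Ricci tensor; contracting again with \<open>g\<^sup>j\<^sup>k\<close> makes two of the three terms divergences of the
  Ricci tensor and the third the derivative of the scalar curvature.\<close>

lemma contracted_bianchi:
  assumes p: "p \<in> chart_dom ch"
  shows "2 * (\<Sum>j\<in>UNIV. \<Sum>k\<in>UNIV. gu j k p * nabla2 g ch Ric j k i p) = pd ch i (scalar_curvature g ch) p"
proof -
  have once: "(\<Sum>l\<in>UNIV. nablaR l l i j k p) = nabla2 g ch Ric i j k p - nabla2 g ch Ric j i k p" for j k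
  proof -
    have "(\<Sum>l\<in>UNIV. nablaR l l i j k p + nablaR i l j l k p + nablaR j l l i k p) = 0"
      by (simp add: second_bianchi[OF p])
    then show ?thesis
      by (simp add: sum.distrib sum_subtractf nablaR_antisym[OF p, of i _ j] nablaR_trace[OF p])
  qed
  have "(\<Sum>l\<in>UNIV. \<Sum>j\<in>UNIV. \<Sum>k\<in>UNIV. gu j k p * nablaR l l i j k p) =
      (\<Sum>j\<in>UNIV. \<Sum>k\<in>UNIV. gu j k p * (\<Sum>l\<in>UNIV. nablaR l l i j k p))"
  proof -
    have "(\<Sum>l\<in>UNIV. \<Sum>j\<in>UNIV. \<Sum>k\<in>UNIV. gu j k p * nablaR l l i j k p) =
        (\<Sum>j\<in>UNIV. \<Sum>l\<in>UNIV. \<Sum>k\<in>UNIV. gu j k p * nablaR l l i j k p)" by (rule sum.swap)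
    also have "\<dots> = (\<Sum>j\<in>UNIV. \<Sum>k\<in>UNIV. \<Sum>l\<in>UNIV. gu j k p * nablaR l l i j k p)"
      by (intro sum.cong refl sum.swap)
    finally show ?thesis by (simp add: sum_distrib_left)
  qed
  also have "\<dots> = pd ch i (scalar_curvature g ch) p - (\<Sum>j\<in>UNIV. \<Sum>k\<in>UNIV. gu j k p * nabla2 g ch Ric j i k p)"
    unfolding once scalar_curvature_def pd_trace2[OF p smooth_ricci]
    by (simp add: right_diff_distrib sum_subtractf)
  also have "(\<Sum>j\<in>UNIV. \<Sum>k\<in>UNIV. gu j k p * nabla2 g ch Ric j i k p) =
      (\<Sum>j\<in>UNIV. \<Sum>k\<in>UNIV. gu j k p * nabla2 g ch Ric j k i p)"
    by (intro sum.cong refl arg_cong2[of _ _ _ _ "(*)"] nabla2_swap_cong[OF ricci_commute smooth_ricci p])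
  finally show ?thesis
    unfolding contract_nablaR_last[OF p] by simp
qed


section \<open>Gradient, divergence and the Bochner formula\<close>

text \<open>The inner product of covectors. Working with differentials instead of gradients keeps the
  metric out of all derivatives.\<close>

definition cometric :: "'a \<Rightarrow> ('n \<Rightarrow> real) \<Rightarrow> ('n \<Rightarrow> real) \<Rightarrow> real" where
  "cometric p \<alpha> \<beta> = (\<Sum>i\<in>UNIV. \<Sum>j\<in>UNIV. gu i j p * (\<alpha> i * \<beta> j))"

lemma cometric_commute: "p \<in> chart_dom ch \<Longrightarrow> cometric p \<alpha> \<beta> = cometric p \<beta> \<alpha>"
  unfolding cometric_def by (subst sum.swap) (simp add: gu_commute[of p _ "_::'n"] mult.commute)

lemma cometric_add_left: "cometric p (\<lambda>i. \<alpha> i + \<beta> i) \<gamma> = cometric p \<alpha> \<gamma> + cometric p \<beta> \<gamma>"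
  by (simp add: cometric_def algebra_simps sum.distrib)

lemma cometric_scale_left: "cometric p (\<lambda>i. k * \<alpha> i) \<beta> = k * cometric p \<alpha> \<beta>"
  by (simp add: cometric_def sum_distrib_left mult_ac)

lemma ginner_grad:
  assumes p: "p \<in> chart_dom ch"
  shows "ginner g ch p (grad g ch u p) (grad g ch v p) = cometric p (\<lambda>i. pd ch i u p) (\<lambda>i. pd ch i v p)"
proof -
  have "(g ch p *v grad g ch v p) $ i = pd ch i v p" for i
    using gd_gu_cancel[OF p] by (simp add: matrix_vector_mult_def grad_def)
  then have "ginner g ch p (grad g ch u p) (grad g ch v p) =
      (\<Sum>i\<in>UNIV. \<Sum>j\<in>UNIV. gu i j p * (pd ch j u p * pd ch i v p))"
    by (simp add: ginner_def inner_vec_def grad_def sum_distrib_right mult.assoc)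
  also have "\<dots> = cometric p (\<lambda>i. pd ch i v p) (\<lambda>i. pd ch i u p)"
    by (simp add: cometric_def mult.commute)
  finally show ?thesis by (simp add: cometric_commute[OF p])
qed

lemma smooth_gnorm2_grad:
  assumes "smooth u" shows "smooth (\<lambda>q. gnorm2 g ch q (grad g ch u q))"
proof -
  have "smooth (\<lambda>q. cometric q (\<lambda>i. pd ch i u q) (\<lambda>i. pd ch i u q))"
    unfolding cometric_def by (intro smooth_tensors assms)
  then show ?thesis
    using smooth_cong[of "\<lambda>q. gnorm2 g ch q (grad g ch u q)"] by (simp add: gnorm2_def ginner_grad)
qed

lemma pd_gnorm2_grad:
  assumes p: "p \<in> chart_dom ch" and u: "smooth u"
  shows "pd ch b (\<lambda>q. gnorm2 g ch q (grad g ch u q)) p =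
    2 * cometric p (\<lambda>i. hessian g ch u b i p) (\<lambda>i. pd ch i u p)"
proof -
  have "pd ch b (\<lambda>q. gnorm2 g ch q (grad g ch u q)) p =
      pd ch b (\<lambda>q. \<Sum>i\<in>UNIV. \<Sum>j\<in>UNIV. gu i j q * (pd ch i u q * pd ch j u q)) p"
    by (rule pd_cong)
      (use p u in \<open>simp_all add: gnorm2_def[symmetric] smooth_gnorm2_grad smooth_imp_diff_at
        cometric_def[symmetric] ginner_grad[symmetric]\<close>)
  also have "\<dots> = cometric p (\<lambda>i. hessian g ch u b i p) (\<lambda>i. pd ch i u p)
      + cometric p (\<lambda>i. pd ch i u p) (\<lambda>i. hessian g ch u b i p)"
    using p u by (simp add: pd_contract smooth_mult smooth_pd nabla2_tensor_product hessian_def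
        cometric_def distrib_left sum.distrib)
  finally show ?thesis by (simp add: cometric_commute[OF p])
qed

text \<open>Symmetry of the Hessian moves the contracted derivative next to another one, and the Ricci
  identity exchanges them.\<close>

lemma nabla2_hessian_trace:
  assumes p: "p \<in> chart_dom ch" and u: "smooth u"
  shows "(\<Sum>a\<in>UNIV. \<Sum>b\<in>UNIV. gu a b p * nabla2 g ch (hessian g ch u) a b i p) =
    pd ch i (laplacian g ch u) p + cometric p (\<lambda>j. pd ch j u p) (\<lambda>j. Ric j i p)"
proof -
  have "nabla2 g ch (hessian g ch u) a b i p =
      nabla2 g ch (hessian g ch u) i a b p + (\<Sum>l\<in>UNIV. pd ch l u p * Rie l i a b p)" for a b
    using ricci_identity[OF p, of "\<lambda>j. pd ch j u" i a b] u
      nabla2_swap_cong[of "hessian g ch u" p a b i]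
    by (simp add: hessian_def[symmetric] hessian_commute smooth_pd smooth_hessian p mult.commute)
  moreover have "(\<Sum>a\<in>UNIV. \<Sum>b\<in>UNIV. gu a b p * (\<Sum>l\<in>UNIV. pd ch l u p * Rie l i a b p)) =
      cometric p (\<lambda>j. pd ch j u p) (\<lambda>j. Ric j i p)"
  proof -
    have "(\<Sum>a\<in>UNIV. \<Sum>b\<in>UNIV. gu a b p * (\<Sum>l\<in>UNIV. pd ch l u p * Rie l i a b p)) =
        (\<Sum>a\<in>UNIV. \<Sum>l\<in>UNIV. \<Sum>b\<in>UNIV. pd ch l u p * (gu a b p * Rie l i a b p))"
      unfolding sum_distrib_left by (simp add: mult.left_commute, intro sum.cong refl sum.swap)
    also have "\<dots> = (\<Sum>l\<in>UNIV. \<Sum>a\<in>UNIV. \<Sum>b\<in>UNIV. pd ch l u p * (gu a b p * Rie l i a b p))"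
      by (rule sum.swap)
    also have "\<dots> = (\<Sum>l\<in>UNIV. pd ch l u p * (\<Sum>t\<in>UNIV. gu l t p * Ric t i p))"
      by (simp add: sum_distrib_left[symmetric] contract_riemann_last[OF p])
    finally show ?thesis by (simp add: cometric_def sum_distrib_left mult_ac)
  qed
  ultimately show ?thesis
    by (simp add: distrib_left sum.distrib laplacian_def pd_trace2[OF p smooth_hessian[OF u]])
qed

lemma nabla1_cong:
  assumes "\<And>j q. q \<in> chart_dom ch \<Longrightarrow> \<alpha> j q = \<beta> j q" "\<And>j. smooth (\<alpha> j)" "p \<in> chart_dom ch"
  shows "nabla1 g ch \<alpha> i j p = nabla1 g ch \<beta> i j p"
  using assms by (simp add: nabla1_def pd_cong[of "\<alpha> j" "\<beta> j"] smooth_imp_diff_at)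

lemma hessian_gnorm2_grad:
  assumes p: "p \<in> chart_dom ch" and u: "smooth u"
  shows "hessian g ch (\<lambda>q. gnorm2 g ch q (grad g ch u q)) a b p =
    2 * cometric p (\<lambda>i. nabla2 g ch (hessian g ch u) a b i p) (\<lambda>i. pd ch i u p) +
    2 * cometric p (\<lambda>i. hessian g ch u b i p) (\<lambda>i. hessian g ch u a i p)"
proof -
  define \<omega> where "\<omega> b q = (\<Sum>i\<in>UNIV. \<Sum>j\<in>UNIV. gu i j q * (hessian g ch u b i q * pd ch j u q))" for b q
  have \<omega>: "smooth (\<omega> b)" for b
    unfolding \<omega>_def[abs_def] by (intro smooth_tensors u)
  have "hessian g ch (\<lambda>q. gnorm2 g ch q (grad g ch u q)) a b p = nabla1 g ch (\<lambda>b q. 2 * \<omega> b q) a b p"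
    unfolding hessian_def
    by (rule nabla1_cong)
      (simp_all add: p u pd_gnorm2_grad \<omega>_def cometric_def smooth_pd smooth_gnorm2_grad)
  also have "\<dots> = 2 * nabla1 g ch \<omega> a b p"
    using p by (simp add: nabla1_def pd_cmult \<omega> smooth_imp_diff_at right_diff_distrib
        sum_distrib_left mult.left_commute)
  also have "nabla1 g ch \<omega> a b p =
     cometric p (\<lambda>i. nabla2 g ch (hessian g ch u) a b i p) (\<lambda>i. pd ch i u p) +
     cometric p (\<lambda>i. hessian g ch u b i p) (\<lambda>i. hessian g ch u a i p)"
    unfolding \<omega>_def[abs_def]
    by (subst nabla1_contract[OF p])
      (simp_all add: u smooth_hessian smooth_pd cometric_def distrib_left sum.distrib hessian_def[symmetric])
  finally show ?thesis by simp
qed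

text \<open>The Bochner formula: commuting the third derivatives of \<open>u\<close> into a gradient of the
  Laplacian costs a Ricci term.\<close>

lemma bochner:
  assumes p: "p \<in> chart_dom ch" and u: "smooth u"
  shows "laplacian g ch (\<lambda>q. gnorm2 g ch q (grad g ch u q)) p =
    2 * (\<Sum>a\<in>UNIV. \<Sum>b\<in>UNIV. gu a b p *
      cometric p (\<lambda>i. hessian g ch u b i p) (\<lambda>i. hessian g ch u a i p)) +
    2 * cometric p (\<lambda>i. pd ch i (laplacian g ch u) p) (\<lambda>i. pd ch i u p) +
    2 * cometric p (\<lambda>i. cometric p (\<lambda>j. pd ch j u p) (\<lambda>j. Ric j i p)) (\<lambda>i. pd ch i u p)"
proof -
  have pull: "(\<Sum>a\<in>UNIV. \<Sum>b\<in>UNIV. gu a b p * cometric p (T a b) \<beta>) =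
      cometric p (\<lambda>i. \<Sum>a\<in>UNIV. \<Sum>b\<in>UNIV. gu a b p * T a b i) \<beta>" for T \<beta>
  proof -
    have sum1: "cometric p (\<lambda>i. \<Sum>a\<in>I. U a i) \<beta> = (\<Sum>a\<in>I. cometric p (U a) \<beta>)"
      for U and I :: "'n set"
      by (induction I rule: infinite_finite_induct)
        (simp_all add: cometric_add_left, simp_all add: cometric_def)
    show ?thesis by (simp add: sum1 cometric_scale_left)
  qed
  show ?thesis
    unfolding laplacian_def[of _ _ "\<lambda>q. gnorm2 g ch q (grad g ch u q)"] trace2_def
      hessian_gnorm2_grad[OF p u]
    using pull[of "\<lambda>a b i. nabla2 g ch (hessian g ch u) a b i p"]
    by (simp add: distrib_left sum.distrib sum_distrib_left[symmetric] mult.left_commute[of _ 2]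
        nabla2_hessian_trace[OF p u] cometric_add_left)
qed

lemma divergence_grad:
  assumes p: "p \<in> chart_dom ch" and u: "smooth u"
  shows "divergence g ch (grad g ch u) p = laplacian g ch u p"
proof -
  have swap: "(\<Sum>i\<in>UNIV. \<Sum>j\<in>UNIV. (\<Sum>s\<in>UNIV. \<Gamma> i i s p * gu s j p) * pd ch j u p) =
      (\<Sum>i\<in>UNIV. \<Sum>k\<in>UNIV. \<Gamma> i i k p * (\<Sum>j\<in>UNIV. gu k j p * pd ch j u p))"
    unfolding sum_distrib_left sum_distrib_right
    by (simp add: mult.assoc, intro sum.cong refl sum.swap)
  have swap': "(\<Sum>i\<in>UNIV. \<Sum>j\<in>UNIV. (\<Sum>s\<in>UNIV. \<Gamma> j i s p * gu i s p) * pd ch j u p) =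
      (\<Sum>i\<in>UNIV. \<Sum>j\<in>UNIV. gu i j p * (\<Sum>k\<in>UNIV. \<Gamma> k i j p * pd ch k u p))"
    unfolding sum_distrib_left sum_distrib_right
    by (simp add: mult_ac, intro sum.cong refl sum.swap)
  have "(\<Sum>i\<in>UNIV. pd ch i (\<lambda>q. grad g ch u q $ i) p) =
      (\<Sum>i\<in>UNIV. \<Sum>j\<in>UNIV. pd ch i (gu i j) p * pd ch j u p) +
      (\<Sum>i\<in>UNIV. \<Sum>j\<in>UNIV. gu i j p * pd ch i (pd ch j u) p)"
    using p u by (simp add: grad_def pd_simps diff_at_intros smooth_imp_diff_at smooth_gu smooth_pd sum.distrib)
  then show ?thesis
    unfolding divergence_def sum.distrib laplacian_def trace2_def hessian_def nabla1_def pd_gu[OF p]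
    by (simp add: grad_def left_diff_distrib right_diff_distrib sum_subtractf sum_negf swap swap')
qed

lemma diff_at_grad: "p \<in> chart_dom ch \<Longrightarrow> smooth u \<Longrightarrow> diff_at (\<lambda>q. grad g ch u q $ i) p"
  by (simp add: grad_def smooth_imp_diff_at smooth_sum smooth_mult smooth_gu smooth_pd)

lemma divergence_scaled_grad:
  assumes p: "p \<in> chart_dom ch" and u: "smooth u" and a: "diff_at a p"
  shows "divergence g ch (\<lambda>q. a q *\<^sub>R grad g ch u q) p =
    a p * laplacian g ch u p + cometric p (\<lambda>i. pd ch i a p) (\<lambda>i. pd ch i u p)"
proof -
  have "divergence g ch (\<lambda>q. a q *\<^sub>R grad g ch u q) p =
      a p * divergence g ch (grad g ch u) p + (\<Sum>i\<in>UNIV. pd ch i a p * grad g ch u p $ i)"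
    unfolding divergence_def
    using p u a by (simp add: pd_mult diff_at_grad sum.distrib distrib_left sum_distrib_left mult_ac)
  then show ?thesis
    by (simp add: divergence_grad[OF p u] cometric_def grad_def sum_distrib_left mult_ac)
qed

lemma divergence_add:
  assumes "\<And>i. diff_at (\<lambda>q. U q $ i) p" "\<And>i. diff_at (\<lambda>q. V q $ i) p"
  shows "divergence g ch (\<lambda>q. U q + V q) p = divergence g ch U p + divergence g ch V p"
  using assms by (simp add: divergence_def pd_add sum.distrib distrib_left)

section \<open>Orthonormal frames\<close>

definition orthonormal_frame :: "'a \<Rightarrow> ('n \<Rightarrow> real ^ 'n) \<Rightarrow> bool" where
  "orthonormal_frame p e \<longleftrightarrow> (\<forall>x y. e x \<bullet> (g ch p *v e y) = (if x = y then 1 else 0))"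

text \<open>Gram-Schmidt for the inner product \<open>g\<close> at \<open>p\<close>: fewer than \<open>n\<close> vectors leave a nonzero vector
  that is Euclidean-orthogonal to their images under the matrix of \<open>g\<close>, which means
  \<open>g\<close>-orthogonal to the vectors themselves.\<close>

lemma exists_orthonormal_set:
  assumes p: "p \<in> chart_dom ch"
  shows "k \<le> CARD('n) \<Longrightarrow> \<exists>B. finite B \<and> card B = k \<and>
    (\<forall>v\<in>B. \<forall>w\<in>B. v \<bullet> (g ch p *v w) = (if v = w then 1 else 0))"
proof (induction k)
  case 0
  show ?case by (intro exI[of _ "{}"]) simp
next
  case (Suc k)
  then obtain B where B: "finite B" "card B = k"
    "\<And>v w. v \<in> B \<Longrightarrow> w \<in> B \<Longrightarrow> v \<bullet> (g ch p *v w) = (if v = w then 1 else 0)" by auto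
  have sym: "v \<bullet> (g ch p *v w) = w \<bullet> (g ch p *v v)" for v w
    by (metis dot_lmul_matrix inner_commute symmetric_metric[OF p] transpose_matrix_vector)
  have "dim ((*v) (g ch p) ` B) < DIM(real ^ 'n)"
    using dim_le_card[of "(*v) (g ch p) ` B" "(*v) (g ch p) ` B"] B(1)
      card_image_le[OF B(1), of "(*v) (g ch p)"] Suc.prems B(2) by (simp add: span_superset)
  then obtain a where a: "a \<noteq> 0" "\<And>x. x \<in> span ((*v) (g ch p) ` B) \<Longrightarrow> a \<bullet> x = 0"
    using orthogonal_to_subspace_exists unfolding orthogonal_def by blast
  define r where "r = sqrt (a \<bullet> (g ch p *v a))"
  have r: "r > 0" "r * r = a \<bullet> (g ch p *v a)"
    using posdef_metric[OF p a(1)] by (simp_all add: r_def)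
  define b where "b = (1 / r) *\<^sub>R a"
  have bb: "b \<bullet> (g ch p *v b) = 1"
    using r(1) by (simp add: b_def matrix_vector_mult_scaleR r(2)[symmetric])
  have bB: "b \<bullet> (g ch p *v w) = 0" if "w \<in> B" for w
    using a(2)[OF span_base, of "g ch p *v w"] that by (simp add: b_def)
  have Bb: "w \<bullet> (g ch p *v b) = 0" if "w \<in> B" for w
    using bB[OF that] sym[of w b] by simp
  have "b \<notin> B" using bb bB by force
  then show ?case
    using B bb bB Bb by (intro exI[of _ "insert b B"]) auto
qed

lemma exists_orthonormal_frame:
  assumes "p \<in> chart_dom ch"
  obtains e where "orthonormal_frame p e"
proof -
  obtain B where B: "finite B" "card B = CARD('n)"
    "\<And>v w. v \<in> B \<Longrightarrow> w \<in> B \<Longrightarrow> v \<bullet> (g ch p *v w) = (if v = w then 1 else 0)"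
    using exists_orthonormal_set[OF assms, of "CARD('n)"] by auto
  then obtain e where e: "bij_betw e (UNIV :: 'n set) B"
    using finite_same_card_bij[of "UNIV :: 'n set" B] by auto
  have "orthonormal_frame p e"
    unfolding orthonormal_frame_def
    using B(3) e by (auto simp: bij_betw_def inj_def)
  then show ?thesis by (rule that)
qed

end

text \<open>The value of a covector on the frame vector \<open>e x\<close>. Components of higher tensors are nested
  applications, one for each index, so that linearity in each index comes from the same rules.\<close>

definition frame_comp :: "('n::finite \<Rightarrow> real ^ 'n) \<Rightarrow> ('n \<Rightarrow> real) \<Rightarrow> 'n \<Rightarrow> real" where
  "frame_comp e \<alpha> x = (\<Sum>i\<in>UNIV. e x $ i * \<alpha> i)"

lemma frame_comp_linear:
  "frame_comp e (\<lambda>i. \<alpha> i + \<beta> i) x = frame_comp e \<alpha> x + frame_comp e \<beta> x"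
  "frame_comp e (\<lambda>i. \<alpha> i - \<beta> i) x = frame_comp e \<alpha> x - frame_comp e \<beta> x"
  "frame_comp e (\<lambda>i. - \<alpha> i) x = - frame_comp e \<alpha> x"
  "frame_comp e (\<lambda>i. k * \<alpha> i) x = k * frame_comp e \<alpha> x"
  "frame_comp e (\<lambda>i. \<alpha> i * k) x = frame_comp e \<alpha> x * k"
  by (simp_all add: frame_comp_def algebra_simps sum.distrib sum_subtractf sum_negf sum_distrib_left)

lemma frame_comp_sum:
  "frame_comp e (\<lambda>i. \<Sum>y\<in>S. \<alpha> y i) x = (\<Sum>y\<in>S. frame_comp e (\<alpha> y) x)"
  unfolding frame_comp_def sum_distrib_left by (rule sum.swap)

lemma frame_comp_swap:
  "frame_comp e (\<lambda>i. frame_comp e (\<lambda>j. T i j) y) x = frame_comp e (\<lambda>j. frame_comp e (\<lambda>i. T i j) x) y"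
  unfolding frame_comp_def sum_distrib_left by (subst sum.swap) (simp add: mult.left_commute)

lemma frame_comp_swap3:
  "frame_comp e (\<lambda>i. frame_comp e (\<lambda>j. frame_comp e (\<lambda>k. T i j k) z) y) x =
   frame_comp e (\<lambda>j. frame_comp e (\<lambda>k. frame_comp e (\<lambda>i. T i j k) x) z) y"
  by (subst frame_comp_swap, subst (2) frame_comp_swap) (rule refl)

lemma frame_comp_swap4:
  "frame_comp e (\<lambda>i. frame_comp e (\<lambda>j. frame_comp e (\<lambda>k. frame_comp e (\<lambda>l. T i j k l) t) z) y) x =
   frame_comp e (\<lambda>k. frame_comp e (\<lambda>l. frame_comp e (\<lambda>i. frame_comp e (\<lambda>j. T i j k l) y) x) t) z"
  by (simp only: frame_comp_swap3[of e _ _ _ y] frame_comp_swap3[of e _ _ _ x])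

context metric_chart begin

text \<open>If \<open>E\<close> has the frame vectors as rows, orthonormality reads \<open>E g E\<^sup>T = 1\<close>. Left inverses of square
  matrices are right inverses, so \<open>g E\<^sup>T E = 1\<close>.\<close>

lemma gu_frame:
  assumes p: "p \<in> chart_dom ch" and e: "orthonormal_frame p e"
  shows "gu i j p = (\<Sum>x\<in>UNIV. e x $ i * e x $ j)"
proof -
  define E where "E = (\<chi> x i. e x $ i)"
  have "E ** (g ch p ** transpose E) = mat 1"
    using e
    by (simp add: orthonormal_frame_def E_def vec_eq_iff mat_def matrix_matrix_mult_def transpose_def
        inner_vec_def matrix_vector_mult_def)
  then have "(g ch p ** transpose E) ** E = mat 1"
    by (simp add: matrix_left_right_inverse)
  then have "transpose E ** E = matrix_inv (g ch p)"
    using matrix_inv_metric(2)[OF p]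
    by (metis (no_types) matrix_mul_assoc matrix_mul_lid matrix_mul_rid)
  then have "matrix_inv (g ch p) $ i $ j = (transpose E ** E) $ i $ j" by simp
  then show ?thesis
    by (simp add: ginv_def E_def matrix_matrix_mult_def transpose_def)
qed

lemma gd_frame:
  assumes "orthonormal_frame p e"
  shows "frame_comp e (\<lambda>i. frame_comp e (\<lambda>j. gd i j p) y) x = (if x = y then 1 else 0)"
  using assms
  by (simp add: orthonormal_frame_def frame_comp_def inner_vec_def matrix_vector_mult_def mult.commute)

lemma contract_frame:
  assumes "p \<in> chart_dom ch" "orthonormal_frame p e"
  shows "(\<Sum>i\<in>UNIV. \<Sum>j\<in>UNIV. gu i j p * T i j) = (\<Sum>x\<in>UNIV. frame_comp e (\<lambda>i. frame_comp e (T i) x) x)"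
proof -
  have "(\<Sum>i\<in>UNIV. \<Sum>j\<in>UNIV. gu i j p * T i j) =
      (\<Sum>i\<in>UNIV. \<Sum>x\<in>UNIV. \<Sum>j\<in>UNIV. e x $ i * (e x $ j * T i j))"
    unfolding gu_frame[OF assms] sum_distrib_right mult.assoc by (intro sum.cong refl sum.swap)
  also have "\<dots> = (\<Sum>x\<in>UNIV. \<Sum>i\<in>UNIV. \<Sum>j\<in>UNIV. e x $ i * (e x $ j * T i j))" by (rule sum.swap)
  finally show ?thesis by (simp add: frame_comp_def sum_distrib_left)
qed

lemma cometric_frame:
  assumes "p \<in> chart_dom ch" "orthonormal_frame p e"
  shows "cometric p \<alpha> \<beta> = (\<Sum>x\<in>UNIV. frame_comp e \<alpha> x * frame_comp e \<beta> x)"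
  unfolding cometric_def contract_frame[OF assms] by (simp add: frame_comp_linear)

lemma tensor3_norm2_frame:
  assumes "p \<in> chart_dom ch" "orthonormal_frame p e"
  shows "tensor3_norm2 g ch T p = (\<Sum>x\<in>UNIV. \<Sum>y\<in>UNIV. \<Sum>z\<in>UNIV.
    (frame_comp e (\<lambda>i. frame_comp e (\<lambda>j. frame_comp e (\<lambda>k. T i j k p) z) y) x)\<^sup>2)"
proof -
  note c = cometric_frame[OF assms, unfolded cometric_def]
  have "tensor3_norm2 g ch T p = (\<Sum>i\<in>UNIV. \<Sum>a\<in>UNIV. \<Sum>j\<in>UNIV. \<Sum>b\<in>UNIV. \<Sum>k\<in>UNIV. \<Sum>c\<in>UNIV.
      gu i a p * (gu j b p * (gu k c p * (T i j k p * T a b c p))))"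
  proof -
    have swap: "(\<Sum>j\<in>UNIV. \<Sum>k\<in>UNIV. \<Sum>a\<in>UNIV. \<Sum>b\<in>UNIV. u j k a b) =
        (\<Sum>a\<in>UNIV. \<Sum>j\<in>UNIV. \<Sum>b\<in>UNIV. \<Sum>k\<in>UNIV. u j k a b)" for u :: "'n \<Rightarrow> 'n \<Rightarrow> 'n \<Rightarrow> 'n \<Rightarrow> real"
    proof -
      have "(\<Sum>j\<in>UNIV. \<Sum>k\<in>UNIV. \<Sum>a\<in>UNIV. \<Sum>b\<in>UNIV. u j k a b) =
          (\<Sum>j\<in>UNIV. \<Sum>a\<in>UNIV. \<Sum>k\<in>UNIV. \<Sum>b\<in>UNIV. u j k a b)"
        by (intro sum.cong refl sum.swap)
      also have "\<dots> = (\<Sum>a\<in>UNIV. \<Sum>j\<in>UNIV. \<Sum>k\<in>UNIV. \<Sum>b\<in>UNIV. u j k a b)" by (rule sum.swap)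
      also have "\<dots> = (\<Sum>a\<in>UNIV. \<Sum>j\<in>UNIV. \<Sum>b\<in>UNIV. \<Sum>k\<in>UNIV. u j k a b)"
        by (intro sum.cong refl sum.swap)
      finally show ?thesis .
    qed
    have "tensor3_norm2 g ch T p = (\<Sum>i\<in>UNIV. \<Sum>a\<in>UNIV. \<Sum>j\<in>UNIV. \<Sum>b\<in>UNIV. \<Sum>k\<in>UNIV. \<Sum>c\<in>UNIV.
        gu i a p * gu j b p * gu k c p * T i j k p * T a b c p)"
      unfolding tensor3_norm2_def by (rule sum.cong[OF refl swap])
    then show ?thesis by (simp add: mult.assoc)
  qed
  also have "\<dots> = (\<Sum>z\<in>UNIV. \<Sum>y\<in>UNIV. \<Sum>x\<in>UNIV.
      (frame_comp e (\<lambda>i. frame_comp e (\<lambda>j. frame_comp e (\<lambda>k. T i j k p) z) y) x)\<^sup>2)"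
  proof -
    have pull: "(\<Sum>i\<in>UNIV. \<Sum>a\<in>UNIV. gu i a p * (\<Sum>z\<in>UNIV. u z i a)) =
        (\<Sum>z\<in>UNIV. \<Sum>i\<in>UNIV. \<Sum>a\<in>UNIV. gu i a p * u z i a)" for u :: "'n \<Rightarrow> 'n \<Rightarrow> 'n \<Rightarrow> real"
    proof -
      have "(\<Sum>i\<in>UNIV. \<Sum>a\<in>UNIV. gu i a p * (\<Sum>z\<in>UNIV. u z i a)) =
          (\<Sum>i\<in>UNIV. \<Sum>z\<in>UNIV. \<Sum>a\<in>UNIV. gu i a p * u z i a)"
        unfolding sum_distrib_left by (intro sum.cong refl sum.swap)
      also have "\<dots> = (\<Sum>z\<in>UNIV. \<Sum>i\<in>UNIV. \<Sum>a\<in>UNIV. gu i a p * u z i a)" by (rule sum.swap)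
      finally show ?thesis .
    qed
    show ?thesis
      unfolding sum_distrib_left[symmetric] c pull by (simp add: power2_eq_square)
  qed
  also have "\<dots> = (\<Sum>z\<in>UNIV. \<Sum>x\<in>UNIV. \<Sum>y\<in>UNIV.
      (frame_comp e (\<lambda>i. frame_comp e (\<lambda>j. frame_comp e (\<lambda>k. T i j k p) z) y) x)\<^sup>2)"
    by (intro sum.cong refl sum.swap)
  also have "\<dots> = (\<Sum>x\<in>UNIV. \<Sum>z\<in>UNIV. \<Sum>y\<in>UNIV.
      (frame_comp e (\<lambda>i. frame_comp e (\<lambda>j. frame_comp e (\<lambda>k. T i j k p) z) y) x)\<^sup>2)"
    by (rule sum.swap)
  also have "\<dots> = (\<Sum>x\<in>UNIV. \<Sum>y\<in>UNIV. \<Sum>z\<in>UNIV.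
      (frame_comp e (\<lambda>i. frame_comp e (\<lambda>j. frame_comp e (\<lambda>k. T i j k p) z) y) x)\<^sup>2)"
    by (intro sum.cong refl sum.swap)
  finally show ?thesis .
qed

text \<open>The frame components of \<open>Rlow\<close>, with the lowered index \<open>t\<close> first: \<open>\<langle>R(e\<^sub>x, e\<^sub>y)e\<^sub>z, e\<^sub>t\<rangle>\<close>.\<close>

definition Rframe :: "'a \<Rightarrow> ('n \<Rightarrow> real ^ 'n) \<Rightarrow> 'n \<Rightarrow> 'n \<Rightarrow> 'n \<Rightarrow> 'n \<Rightarrow> real" where
  "Rframe p e t x y z = frame_comp e (\<lambda>i. frame_comp e (\<lambda>j. frame_comp e (\<lambda>k.
     frame_comp e (\<lambda>l. Rlow l i j k p) t) z) y) x"

lemma Rframe_antisym: "Rframe p e t x y z = - Rframe p e t y x z"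
proof -
  have "Rframe p e t x y z = frame_comp e (\<lambda>i. frame_comp e (\<lambda>j. - frame_comp e (\<lambda>k.
     frame_comp e (\<lambda>l. Rlow l j i k p) t) z) y) x"
    unfolding Rframe_def frame_comp_linear(3)[symmetric] Rlow_antisym[of _ _ _ _ p, symmetric] ..
  then show ?thesis
    unfolding frame_comp_linear(3) frame_comp_swap[of e _ y x] Rframe_def .
qed

lemma Rframe_antisym_outer:
  assumes "p \<in> chart_dom ch"
  shows "Rframe p e t x y z = - Rframe p e z x y t"
proof -
  have "Rframe p e t x y z = frame_comp e (\<lambda>i. frame_comp e (\<lambda>j. frame_comp e (\<lambda>k.
     frame_comp e (\<lambda>l. - Rlow k i j l p) t) z) y) x"
    unfolding Rframe_def Rlow_antisym_outer[OF assms, symmetric] ..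
  then show ?thesis
    unfolding frame_comp_linear(3) frame_comp_swap[of e _ t z] Rframe_def .
qed

lemma Rframe_pair_symmetric:
  assumes "p \<in> chart_dom ch"
  shows "Rframe p e t x y z = Rframe p e y z t x"
proof -
  have "Rframe p e t x y z = frame_comp e (\<lambda>i. frame_comp e (\<lambda>j. frame_comp e (\<lambda>k.
     frame_comp e (\<lambda>l. Rlow j k l i p) t) z) y) x"
    unfolding Rframe_def Rlow_pair_symmetric[OF assms, symmetric] ..
  then show ?thesis
    unfolding frame_comp_swap4[of e _ t z] Rframe_def .
qed

lemma ricci_frame:
  assumes "p \<in> chart_dom ch" "orthonormal_frame p e"
  shows "frame_comp e (\<lambda>j. frame_comp e (\<lambda>k. Ric j k p) z) y = (\<Sum>x\<in>UNIV. Rframe p e x x y z)"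
proof -
  have "frame_comp e (\<lambda>i. frame_comp e (\<lambda>j. frame_comp e (\<lambda>k. frame_comp e (\<lambda>l. Rlow l i j k p) x) z) y) x =
    frame_comp e (\<lambda>j. frame_comp e (\<lambda>k. frame_comp e (\<lambda>i. frame_comp e (\<lambda>l. Rlow l i j k p) x) x) z) y" for x
    by (rule frame_comp_swap3)
  then show ?thesis
    unfolding ricci_eq_contract_Rlow[OF assms(1)] contract_frame[OF assms] frame_comp_sum
    by (simp add: Rframe_def)
qed

lemma riemann_contract_frame:
  assumes p: "p \<in> chart_dom ch" and e: "orthonormal_frame p e"
  shows "frame_comp e (\<lambda>i. frame_comp e (\<lambda>j. frame_comp e (\<lambda>k. \<Sum>l\<in>UNIV. Rie l i j k p * \<alpha> l) z) y) x =
    (\<Sum>t\<in>UNIV. Rframe p e t x y z * frame_comp e \<alpha> t)"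
proof -
  have "(\<Sum>l\<in>UNIV. Rie l i j k p * \<alpha> l) = cometric p \<alpha> (\<lambda>t. Rlow t i j k p)" for i j k
    by (simp add: riemann_eq_raise_Rlow[OF p] cometric_def sum_distrib_left sum_distrib_right mult_ac)
  then show ?thesis
    by (simp add: cometric_frame[OF p e] frame_comp_sum frame_comp_linear Rframe_def mult.commute)
qed

end

section \<open>Dimension three\<close>

text \<open>The tensor on the left is \<open>f\<^sup>2 C\<close> for a static perfect fluid, where \<open>f\<close> now stands for the
  components of \<open>\<nabla>f\<close>.\<close>

lemma cotton_norm_3d:
  fixes H :: "3 \<Rightarrow> 3 \<Rightarrow> real" and f :: "3 \<Rightarrow> real"
  assumes H: "\<And>x y. H x y = H y x"
    and \<delta>: "\<And>x y. \<delta> x y = (if x = y then 1 else 0)"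
    and L: "L = (\<Sum>x\<in>UNIV. H x x)"
    and v: "\<And>x. v x = (\<Sum>y\<in>UNIV. H x y * f y)"
    and W: "W = (\<Sum>x\<in>UNIV. f x * f x)"
  shows "(\<Sum>x\<in>UNIV. \<Sum>y\<in>UNIV. \<Sum>z\<in>UNIV. (2 * (f y * H x z - f x * H y z) + v y * \<delta> x z - v x * \<delta> y z
      - L * (f y * \<delta> x z - f x * \<delta> y z))\<^sup>2) =
    8 * W * (\<Sum>x\<in>UNIV. \<Sum>y\<in>UNIV. (H x y)\<^sup>2) - 12 * (\<Sum>x\<in>UNIV. v x * v x)
    + 8 * L * (\<Sum>x\<in>UNIV. v x * f x) - 4 * L\<^sup>2 * W"
  by (simp add: sum_3 v W L \<delta> H[of 2 1] H[of 3 1] H[of 3 2]) algebra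

text \<open>By its symmetries a curvature tensor in dimension three has six independent components,
  as many as the Ricci tensor; the Weyl tensor vanishes.\<close>

lemma curvature_from_ricci_3d:
  fixes R :: "3 \<Rightarrow> 3 \<Rightarrow> 3 \<Rightarrow> 3 \<Rightarrow> real"
  assumes a: "\<And>t x y z. R t x y z = - R t y x z"
    and b: "\<And>t x y z. R t x y z = - R z x y t"
    and c: "\<And>t x y z. R t x y z = R y z t x"
    and ric: "\<And>y z. P y z = (\<Sum>x\<in>UNIV. R x x y z)"
    and S: "S = (\<Sum>x\<in>UNIV. P x x)"
    and \<delta>: "\<And>x y. \<delta> x y = (if x = y then 1 else 0)"
  shows "R t x y z = P y z * \<delta> x t - P x z * \<delta> y t + \<delta> y z * P x t - \<delta> x z * P y t
    - S / 2 * (\<delta> y z * \<delta> x t - \<delta> x z * \<delta> y t)"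
proof -
  have zero: "R t x x z = 0" "R t x y t = 0" for t x y z
    using a[of t x x z] b[of t x y t] by simp_all
  \<comment> \<open>Rewrite rules that bring every component into one of the six normal forms, with \<open>x < y\<close> and
    \<open>t < z\<close> by antisymmetry and the remaining freedom removed by pair symmetry.\<close>
  note n = zero a[of _ 2 1] a[of _ 3 1] a[of _ 3 2] b[of 2 _ _ 1] b[of 3 _ _ 1] b[of 3 _ _ 2]
  have p: "R 1 1 3 2 = R 1 1 2 3" "R 1 2 3 2 = R 2 1 2 3" "R 1 2 3 3 = R 2 1 3 3"
    using c[of 1 1 3 2] a[of 3 2 1 1] b[of 3 1 2 1] c[of 1 2 3 2] a[of 3 2 1 2] b[of 3 1 2 2]
      c[of 1 2 3 3] a[of 3 3 1 2] b[of 3 1 3 2] by simp_all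
  have "\<forall>t x y z. R t x y z = P y z * \<delta> x t - P x z * \<delta> y t + \<delta> y z * P x t - \<delta> x z * P y t
    - S / 2 * (\<delta> y z * \<delta> x t - \<delta> x z * \<delta> y t)"
    unfolding forall_3 by (simp add: ric S \<delta> sum_3 n p) (simp add: field_simps)
  then show ?thesis by blast
qed

section \<open>Static perfect fluids in a chart\<close>

lemma (in metric_chart) nabla2_metric: "p \<in> chart_dom ch \<Longrightarrow> nabla2 g ch gd i j k p = 0"
  by (simp add: nabla2_def pd_gd sum.distrib gd_commute[of p j])

lemma (in metric_chart) trace2_metric:
  assumes "p \<in> chart_dom ch" shows "trace2 g ch gd p = CARD('n)"
  using gu_gd[OF assms] by (simp add: trace2_def gd_commute[OF assms, of _ "_::'n"])

lemma (in metric_chart) nabla2_scale: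
  assumes "p \<in> chart_dom ch" "smooth u" "\<And>j k. smooth (T j k)"
  shows "nabla2 g ch (\<lambda>j k q. u q * T j k q) i j k p = pd ch i u p * T j k p + u p * nabla2 g ch T i j k p"
  using assms by (simp add: nabla2_def pd_simps smooth_imp_diff_at algebra_simps sum_distrib_left sum.distrib)

lemma (in metric_chart) nabla2_add:
  assumes "p \<in> chart_dom ch" "\<And>j k. smooth (S j k)" "\<And>j k. smooth (T j k)"
  shows "nabla2 g ch (\<lambda>j k q. S j k q + T j k q) i j k p = nabla2 g ch S i j k p + nabla2 g ch T i j k p"
  using assms by (simp add: nabla2_def pd_simps smooth_imp_diff_at algebra_simps sum.distrib)

locale fluid_chart = metric_chart ch g
  for ch :: "('a, 3) chart" and g :: "('a, 3) metric" +
  fixes f \<mu> \<rho> :: "'a \<Rightarrow> real"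
  assumes smooth_fluid: "smooth f" "smooth \<mu>" "smooth \<rho>"
    and lapse_pos: "\<And>p. p \<in> chart_dom ch \<Longrightarrow> f p > 0"
    and einstein: "\<And>p i j. p \<in> chart_dom ch \<Longrightarrow>
      f p * Ric i j p = hessian g ch f i j p + 4 * pi * (\<mu> p - \<rho> p) * f p * gd i j p"
    and laplacian_lapse: "\<And>p. p \<in> chart_dom ch \<Longrightarrow> laplacian g ch f p = 4 * pi * (\<mu> p + 3 * \<rho> p) * f p"
begin

lemma scalar_curvature_fluid:
  assumes p: "p \<in> chart_dom ch"
  shows "scalar_curvature g ch p = 16 * pi * \<mu> p"
proof -
  have "f p * scalar_curvature g ch p = laplacian g ch f p + 4 * pi * (\<mu> p - \<rho> p) * f p * trace2 g ch gd p"
  proof -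
    have "f p * scalar_curvature g ch p = (\<Sum>i\<in>UNIV. \<Sum>j\<in>UNIV. gu i j p * (f p * Ric i j p))"
      by (simp add: scalar_curvature_def trace2_def sum_distrib_left mult.left_commute)
    then show ?thesis
      unfolding einstein[OF p]
      by (simp add: laplacian_def trace2_def distrib_left sum.distrib sum_distrib_left mult.left_commute)
  qed
  then have "f p * scalar_curvature g ch p = f p * (16 * pi * \<mu> p)"
    by (simp add: laplacian_lapse[OF p] trace2_metric[OF p] algebra_simps)
  then show ?thesis using lapse_pos[OF p] by simp
qed

lemma pd_scalar_curvature:
  assumes p: "p \<in> chart_dom ch"
  shows "pd ch i (scalar_curvature g ch) p = 16 * pi * pd ch i \<mu> p"
proof -
  have "pd ch i (scalar_curvature g ch) p = pd ch i (\<lambda>q. 16 * pi * \<mu> q) p"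
    by (rule pd_cong[OF scalar_curvature_fluid])
      (simp_all add: p scalar_curvature_def smooth_imp_diff_at smooth_trace2 smooth_ricci)
  then show ?thesis using p by (simp add: pd_cmult smooth_imp_diff_at smooth_fluid)
qed

lemma pd_laplacian_lapse:
  assumes p: "p \<in> chart_dom ch"
  shows "pd ch i (laplacian g ch f) p =
    4 * pi * (pd ch i \<mu> p + 3 * pd ch i \<rho> p) * f p + 4 * pi * (\<mu> p + 3 * \<rho> p) * pd ch i f p"
proof -
  have "pd ch i (laplacian g ch f) p = pd ch i (\<lambda>q. 4 * pi * (\<mu> q + 3 * \<rho> q) * f q) p"
    by (rule pd_cong[OF laplacian_lapse])
      (simp_all add: p laplacian_def smooth_imp_diff_at smooth_trace2 smooth_hessian smooth_fluid)
  then show ?thesis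
    using p by (simp add: pd_simps diff_at_intros smooth_imp_diff_at smooth_fluid)
qed

lemma nabla2_ricci_fluid:
  assumes p: "p \<in> chart_dom ch"
  shows "f p * nabla2 g ch Ric i j k p = nabla2 g ch (hessian g ch f) i j k p
    + (4 * pi * (pd ch i \<mu> p - pd ch i \<rho> p) * f p + 4 * pi * (\<mu> p - \<rho> p) * pd ch i f p) * gd j k p
    - pd ch i f p * Ric j k p"
proof -
  have \<kappa>: "smooth (\<lambda>q. 4 * pi * (\<mu> q - \<rho> q) * f q)"
    by (intro smooth_intros smooth_fluid)
  have "nabla2 g ch (\<lambda>j k q. f q * Ric j k q) i j k p =
      nabla2 g ch (\<lambda>j k q. hessian g ch f j k q + 4 * pi * (\<mu> q - \<rho> q) * f q * gd j k q) i j k p"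
    by (rule nabla2_cong[OF einstein _ p]) (simp_all add: smooth_mult smooth_ricci smooth_fluid)
  also have "\<dots> = nabla2 g ch (hessian g ch f) i j k p + pd ch i (\<lambda>q. 4 * pi * (\<mu> q - \<rho> q) * f q) p * gd j k p"
    by (simp add: p nabla2_add nabla2_scale \<kappa> smooth_mult[OF \<kappa>] smooth_hessian smooth_fluid smooth_metric nabla2_metric)
  also have "pd ch i (\<lambda>q. 4 * pi * (\<mu> q - \<rho> q) * f q) p =
      4 * pi * (pd ch i \<mu> p - pd ch i \<rho> p) * f p + 4 * pi * (\<mu> p - \<rho> p) * pd ch i f p"
    using p by (simp add: pd_simps diff_at_intros smooth_imp_diff_at smooth_fluid)
  finally show ?thesis
    by (simp add: nabla2_scale p smooth_fluid smooth_ricci)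
qed

text \<open>Euler's equation is the contracted Bianchi identity: the Ricci terms produced by the
  divergence of the Hessian cancel those produced by differentiating the factor \<open>f\<close>.\<close>

lemma pd_pressure:
  assumes p: "p \<in> chart_dom ch"
  shows "pd ch k \<rho> p = - (\<mu> p + \<rho> p) / f p * pd ch k f p"
proof -
  define \<kappa> where "\<kappa> i = 4 * pi * (pd ch i \<mu> p - pd ch i \<rho> p) * f p + 4 * pi * (\<mu> p - \<rho> p) * pd ch i f p" for i
  have trace: "(\<Sum>i\<in>UNIV. \<Sum>j\<in>UNIV. gu i j p * (\<kappa> i * gd j k p)) = \<kappa> k"
  proof -
    have "(\<Sum>i\<in>UNIV. \<Sum>j\<in>UNIV. gu i j p * (\<kappa> i * gd j k p)) =
        (\<Sum>i\<in>UNIV. \<kappa> i * (\<Sum>j\<in>UNIV. gu i j p * gd j k p))"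
      by (simp add: sum_distrib_left mult.left_commute)
    then show ?thesis by (simp add: gu_gd[OF p] if_distrib cong: if_cong)
  qed
  have "f p * (\<Sum>i\<in>UNIV. \<Sum>j\<in>UNIV. gu i j p * nabla2 g ch Ric i j k p) =
      (\<Sum>i\<in>UNIV. \<Sum>j\<in>UNIV. gu i j p * (f p * nabla2 g ch Ric i j k p))"
    by (simp add: sum_distrib_left mult.left_commute)
  also have "\<dots> = pd ch k (laplacian g ch f) p + \<kappa> k"
    unfolding nabla2_ricci_fluid[OF p] \<kappa>_def[symmetric]
    using nabla2_hessian_trace[OF p smooth_fluid(1), of k]
    by (simp add: distrib_left right_diff_distrib sum.distrib sum_subtractf trace cometric_def)
  finally have "f p * (16 * pi * pd ch k \<mu> p) = 2 * (pd ch k (laplacian g ch f) p + \<kappa> k)"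
    using contracted_bianchi[OF p, of k] by (simp add: pd_scalar_curvature[OF p])
  then have "16 * pi * (f p * pd ch k \<rho> p) = 16 * pi * (- (\<mu> p + \<rho> p) * pd ch k f p)"
    by (simp add: pd_laplacian_lapse[OF p] \<kappa>_def algebra_simps)
  then have "f p * pd ch k \<rho> p = - (\<mu> p + \<rho> p) * pd ch k f p"
    unfolding mult_cancel_left using pi_gt_zero by simp
  then show ?thesis using lapse_pos[OF p] by (simp add: field_simps)
qed

text \<open>Antisymmetrise the derivative of the field equation. By Euler's equation the derivatives of
  \<open>\<mu>\<close> and \<open>\<rho>\<close> combine with those of the scalar curvature to a multiple of \<open>\<nabla>f\<close>.\<close>

lemma cotton_fluid:
  assumes p: "p \<in> chart_dom ch"
  shows "f p * cotton g ch i j k p =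
    pd ch j f p * Ric i k p - pd ch i f p * Ric j k p - (\<Sum>l\<in>UNIV. Rie l i j k p * pd ch l f p)
    + 8 * pi * \<mu> p * (pd ch i f p * gd j k p - pd ch j f p * gd i k p)"
proof -
  have Euler: "f p * pd ch i \<rho> p = - (\<mu> p + \<rho> p) * pd ch i f p" for i
    using lapse_pos[OF p] by (simp add: pd_pressure[OF p])
  have mass: "4 * pi * (pd ch i \<mu> p - pd ch i \<rho> p) * f p + 4 * pi * (\<mu> p - \<rho> p) * pd ch i f p
      - f p / 4 * pd ch i (scalar_curvature g ch) p = 8 * pi * \<mu> p * pd ch i f p" for i
  proof -
    have "4 * pi * (pd ch i \<mu> p - pd ch i \<rho> p) * f p + 4 * pi * (\<mu> p - \<rho> p) * pd ch i f p
        - f p / 4 * pd ch i (scalar_curvature g ch) p =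
        - 4 * pi * (f p * pd ch i \<rho> p) + 4 * pi * (\<mu> p - \<rho> p) * pd ch i f p"
      by (simp add: pd_scalar_curvature[OF p] algebra_simps)
    then show ?thesis unfolding Euler by (simp add: algebra_simps)
  qed
  have hess: "nabla2 g ch (hessian g ch f) i j k p - nabla2 g ch (hessian g ch f) j i k p =
      - (\<Sum>l\<in>UNIV. Rie l i j k p * pd ch l f p)"
    using ricci_identity[OF p, of "\<lambda>j. pd ch j f" i j k] by (simp add: hessian_def smooth_pd smooth_fluid)
  have "f p * cotton g ch i j k p = f p * nabla2 g ch Ric i j k p - f p * nabla2 g ch Ric j i k p
      - f p / 4 * pd ch i (scalar_curvature g ch) p * gd j k p
      + f p / 4 * pd ch j (scalar_curvature g ch) p * gd i k p"
    by (simp add: cotton_def algebra_simps)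
  also have "\<dots> = (nabla2 g ch (hessian g ch f) i j k p - nabla2 g ch (hessian g ch f) j i k p)
      + pd ch j f p * Ric i k p - pd ch i f p * Ric j k p
      + (4 * pi * (pd ch i \<mu> p - pd ch i \<rho> p) * f p + 4 * pi * (\<mu> p - \<rho> p) * pd ch i f p
        - f p / 4 * pd ch i (scalar_curvature g ch) p) * gd j k p
      - (4 * pi * (pd ch j \<mu> p - pd ch j \<rho> p) * f p + 4 * pi * (\<mu> p - \<rho> p) * pd ch j f p
        - f p / 4 * pd ch j (scalar_curvature g ch) p) * gd i k p"
    unfolding nabla2_ricci_fluid[OF p] by (simp add: algebra_simps)
  finally show ?thesis
    unfolding hess mass by (simp add: algebra_simps)
qed

text \<open>In an orthonormal frame the curvature is an explicit expression in the Ricci tensor, hence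
  by the field equation in the Hessian.\<close>

lemma cotton_norm_fluid:
  assumes p: "p \<in> chart_dom ch"
  defines "W \<equiv> cometric p (\<lambda>i. pd ch i f p) (\<lambda>i. pd ch i f p)"
    and "v \<equiv> \<lambda>i. cometric p (\<lambda>j. hessian g ch f i j p) (\<lambda>j. pd ch j f p)"
  shows "(f p)^4 * tensor3_norm2 g ch (cotton g ch) p =
    8 * W * (\<Sum>a\<in>UNIV. \<Sum>b\<in>UNIV. gu a b p *
      cometric p (\<lambda>i. hessian g ch f b i p) (\<lambda>i. hessian g ch f a i p))
    - 12 * cometric p v v + 8 * laplacian g ch f p * cometric p v (\<lambda>i. pd ch i f p)
    - 4 * (laplacian g ch f p)\<^sup>2 * W"
proof -
  obtain e where e: "orthonormal_frame p e"
    using exists_orthonormal_frame[OF p] .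
  define \<delta> :: "3 \<Rightarrow> 3 \<Rightarrow> real" where "\<delta> x y = (if x = y then 1 else 0)" for x y
  define \<phi> where "\<phi> = frame_comp e (\<lambda>i. pd ch i f p)"
  define H where "H x y = frame_comp e (\<lambda>i. frame_comp e (\<lambda>j. hessian g ch f i j p) y) x" for x y
  define P where "P x y = frame_comp e (\<lambda>i. frame_comp e (\<lambda>j. Ric i j p) y) x" for x y
  define C where "C x y z = frame_comp e (\<lambda>i. frame_comp e (\<lambda>j. frame_comp e (\<lambda>k. cotton g ch i j k p) z) y) x" for x y z
  define \<kappa> where "\<kappa> = 4 * pi * (\<mu> p - \<rho> p) * f p"
  define L where "L = laplacian g ch f p"
  define S where "S = (\<Sum>x\<in>UNIV. P x x)"
  define s where "s = S / 2"
  define Hf where "Hf x = (\<Sum>y\<in>UNIV. H x y * \<phi> y)" for x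
  note gd_frame = gd_frame[OF e, folded \<delta>_def]
  note cometric_frame = cometric_frame[OF p e]
  have f: "f p \<noteq> 0" using lapse_pos[OF p] by simp
  have L: "L = (\<Sum>x\<in>UNIV. H x x)"
    unfolding L_def laplacian_def trace2_def H_def by (rule contract_frame[OF p e])
  have H_commute: "H x y = H y x" for x y
    unfolding H_def by (subst frame_comp_swap) (simp add: hessian_commute[OF smooth_fluid(1) p, of _ "_::3"])
  have P: "f p * P x y = H x y + \<kappa> * \<delta> x y" for x y
  proof -
    have "f p * P x y = frame_comp e (\<lambda>i. frame_comp e (\<lambda>j. f p * Ric i j p) y) x"
      by (simp add: P_def frame_comp_linear)
    then show ?thesis
      unfolding einstein[OF p] by (simp add: H_def \<kappa>_def frame_comp_linear gd_frame)
  qed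
  have S: "f p * S = L + 3 * \<kappa>"
    unfolding S_def sum_distrib_left P by (simp add: sum.distrib L \<delta>_def)
  have mass: "8 * pi * \<mu> p * f p = f p * S / 2"
  proof -
    have "S = scalar_curvature g ch p"
      unfolding S_def P_def scalar_curvature_def trace2_def by (rule contract_frame[OF p e, symmetric])
    then show ?thesis by (simp add: scalar_curvature_fluid[OF p])
  qed
  have R: "(\<Sum>t\<in>UNIV. Rframe p e t x y z * \<phi> t) =
      P y z * \<phi> x - P x z * \<phi> y + \<delta> y z * (\<Sum>t\<in>UNIV. P x t * \<phi> t) - \<delta> x z * (\<Sum>t\<in>UNIV. P y t * \<phi> t)
      - s * (\<delta> y z * \<phi> x - \<delta> x z * \<phi> y)" for x y z
  proof -
    have "Rframe p e t x y z = P y z * \<delta> x t - P x z * \<delta> y t + \<delta> y z * P x t - \<delta> x z * P y t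
        - s * (\<delta> y z * \<delta> x t - \<delta> x z * \<delta> y t)" for t
      unfolding s_def by (rule curvature_from_ricci_3d[OF Rframe_antisym Rframe_antisym_outer[OF p] Rframe_pair_symmetric[OF p]])
        (simp_all add: P_def ricci_frame[OF p e] S_def \<delta>_def)
    moreover have "(\<Sum>t\<in>UNIV. \<delta> x t * \<phi> t) = \<phi> x" for x
      by (simp add: \<delta>_def if_distrib[of "\<lambda>x. x * _"] cong: if_cong)
    ultimately show ?thesis
      by (simp add: left_diff_distrib distrib_right right_diff_distrib sum.distrib sum_subtractf
          mult.assoc sum_distrib_left[symmetric])
  qed
  have Pf: "f p * (\<Sum>t\<in>UNIV. P x t * \<phi> t) = Hf x + \<kappa> * \<phi> x" for x
  proof -
    have "f p * (\<Sum>t\<in>UNIV. P x t * \<phi> t) = (\<Sum>t\<in>UNIV. (f p * P x t) * \<phi> t)"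
      by (simp add: sum_distrib_left mult.assoc)
    then show ?thesis
      unfolding P Hf_def
      by (simp add: distrib_right sum.distrib \<delta>_def if_distrib[of "\<lambda>x. _ * x"] if_distrib[of "\<lambda>x. x * _"] cong: if_cong)
  qed
  have C: "(f p)\<^sup>2 * C x y z = 2 * (\<phi> y * H x z - \<phi> x * H y z) + Hf y * \<delta> x z - Hf x * \<delta> y z
      - L * (\<phi> y * \<delta> x z - \<phi> x * \<delta> y z)" for x y z
  proof -
    have "f p * C x y z = frame_comp e (\<lambda>i. frame_comp e (\<lambda>j. frame_comp e (\<lambda>k. f p * cotton g ch i j k p) z) y) x"
      by (simp add: C_def frame_comp_linear)
    also have "\<dots> = \<phi> y * P x z - \<phi> x * P y z - (\<Sum>t\<in>UNIV. Rframe p e t x y z * \<phi> t)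
        + 8 * pi * \<mu> p * (\<phi> x * \<delta> y z - \<phi> y * \<delta> x z)"
      unfolding cotton_fluid[OF p]
      by (simp add: frame_comp_linear riemann_contract_frame[OF p e] gd_frame P_def \<phi>_def)
    finally have C1: "f p * C x y z = \<phi> y * P x z - \<phi> x * P y z
        - (\<Sum>t\<in>UNIV. Rframe p e t x y z * \<phi> t)
        + 8 * pi * \<mu> p * (\<phi> x * \<delta> y z - \<phi> y * \<delta> x z)" .
    have "(f p)\<^sup>2 * C x y z = 2 * (\<phi> y * (f p * P x z) - \<phi> x * (f p * P y z))
        + \<delta> x z * (f p * (\<Sum>t\<in>UNIV. P y t * \<phi> t)) - \<delta> y z * (f p * (\<Sum>t\<in>UNIV. P x t * \<phi> t))
        + (f p * S) / 2 * (\<delta> y z * \<phi> x - \<delta> x z * \<phi> y)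
        + (8 * pi * \<mu> p * f p) * (\<phi> x * \<delta> y z - \<phi> y * \<delta> x z)"
      unfolding power2_eq_square mult.assoc[of "f p" "f p"] C1 R s_def by (simp add: algebra_simps)
    then show ?thesis
      unfolding mass S P Pf by (simp add: algebra_simps)
  qed
  have "(f p)^4 * tensor3_norm2 g ch (cotton g ch) p =
      (\<Sum>x\<in>UNIV. \<Sum>y\<in>UNIV. \<Sum>z\<in>UNIV. ((f p)\<^sup>2 * C x y z)\<^sup>2)"
    unfolding tensor3_norm2_frame[OF p e] C_def[symmetric]
    by (simp add: sum_distrib_left power_mult_distrib flip: power_mult)
  also have "\<dots> = 8 * (\<Sum>x\<in>UNIV. \<phi> x * \<phi> x) * (\<Sum>x\<in>UNIV. \<Sum>y\<in>UNIV. (H x y)\<^sup>2)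
      - 12 * (\<Sum>x\<in>UNIV. Hf x * Hf x) + 8 * L * (\<Sum>x\<in>UNIV. Hf x * \<phi> x)
      - 4 * L\<^sup>2 * (\<Sum>x\<in>UNIV. \<phi> x * \<phi> x)"
    unfolding C by (rule cotton_norm_3d[OF H_commute \<delta>_def L Hf_def refl])
  finally have main: "(f p)^4 * tensor3_norm2 g ch (cotton g ch) p =
      8 * (\<Sum>x\<in>UNIV. \<phi> x * \<phi> x) * (\<Sum>x\<in>UNIV. \<Sum>y\<in>UNIV. (H x y)\<^sup>2)
      - 12 * (\<Sum>x\<in>UNIV. Hf x * Hf x) + 8 * L * (\<Sum>x\<in>UNIV. Hf x * \<phi> x)
      - 4 * L\<^sup>2 * (\<Sum>x\<in>UNIV. \<phi> x * \<phi> x)" .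
  have W: "W = (\<Sum>x\<in>UNIV. \<phi> x * \<phi> x)"
    by (simp add: W_def cometric_frame \<phi>_def)
  have v: "frame_comp e v x = Hf x" for x
    unfolding v_def cometric_frame Hf_def H_def \<phi>_def frame_comp_sum frame_comp_linear ..
  have HH: "(\<Sum>a\<in>UNIV. \<Sum>b\<in>UNIV. gu a b p *
      cometric p (\<lambda>i. hessian g ch f b i p) (\<lambda>i. hessian g ch f a i p)) =
      (\<Sum>x\<in>UNIV. \<Sum>y\<in>UNIV. (H x y)\<^sup>2)"
    unfolding cometric_frame contract_frame[OF p e] frame_comp_sum frame_comp_linear H_def[symmetric]
    by (simp add: power2_eq_square)
  show ?thesis
    unfolding HH W cometric_frame[of v] v \<phi>_def[symmetric] L_def[symmetric] by (rule main)
qed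

end

section \<open>The divergence formula\<close>

text \<open>The identity with all tensor quantities at the point replaced by numbers: \<open>N = \<langle>\<nabla>W, \<nabla>f\<rangle>\<close>,
  \<open>M = |\<nabla>W|\<^sup>2\<close>, \<open>Q = |H|\<^sup>2\<close>, \<open>T = |C|\<^sup>2\<close>, \<open>B = Ric(\<nabla>f, \<nabla>f)\<close>, \<open>D = 1 - f\<^sup>2\<close>, \<open>c = 4\<pi>\<close>, and \<open>m\<close>, \<open>r\<close>
  are the derivatives of \<open>\<mu>\<close>, \<open>\<rho>\<close> with respect to \<open>f\<close>.\<close>

lemma divergence_balance:
  fixes f W N M Q L T D F F' G G' m r \<mu> \<rho> B c :: real
  assumes nz: "f \<noteq> 0" "W \<noteq> 0" "D \<noteq> 0"
    and T: "f^4 * T = 8 * W * Q - 3 * M + 4 * L * N - 4 * L\<^sup>2 * W"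
    and B: "f * B = N / 2 + c * (\<mu> - \<rho>) * f * W"
    and L: "L = c * (\<mu> + 3 * \<rho>) * f"
    and r: "f * r = - (\<mu> + \<rho>)"
    and F': "F' = f * (12 * F / D - G)"
    and G': "G' = 48 * f * F / D\<^sup>2"
  shows "F / f * (2 * Q + 2 * ((c * (m + 3 * r) * f + c * (\<mu> + 3 * \<rho>)) * W) + 2 * B)
      + (F' / f - F / f\<^sup>2) * N + (2 * c * (\<mu> - \<rho>) * F + G * W) * L
      + (2 * c * (\<mu> - \<rho>) * F' + 2 * c * (m - r) * F + G' * W) * W + G * N =
    F * f^3 * T / (4 * W) - F * L / (f * W) * N
      + 3 * F / (4 * f * W) * (M + 2 * (8 * (f * W / D)) * N + (8 * (f * W / D))\<^sup>2 * W)
      + c * (3 * \<mu> + \<rho>) * F * L + 24 * c * f * F / D * W * (\<mu> - \<rho>)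
      + c * W * ((5 * \<rho> - \<mu>) * f * G + 4 * F * m)"
proof -
  have "F * f^3 * T / (4 * W) = F / (4 * f * W) * (f^4 * T)"
    using nz by (simp add: field_simps power_numeral_reduce)
  also have "\<dots> = 2 * Q * F / f - 3 * F * M / (4 * f * W) + F * L * N / (f * W) - F * L\<^sup>2 / f"
    unfolding T using nz by (simp add: field_simps)
  finally have cot: "F * f^3 * T / (4 * W) = \<dots>" .
  have sq: "3 * F / (4 * f * W) * (M + 2 * (8 * (f * W / D)) * N + (8 * (f * W / D))\<^sup>2 * W) =
      3 * F * M / (4 * f * W) + 12 * F * N / D + 48 * f * F * W\<^sup>2 / D\<^sup>2"
    using nz by (simp add: field_simps power2_eq_square)
  have LL: "c * (3 * \<mu> + \<rho>) * F * L - F * L\<^sup>2 / f = 2 * c * (\<mu> - \<rho>) * F * L"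
    using nz unfolding L by (simp add: field_simps power2_eq_square)
  have Bf: "F / f * B = F * N / (2 * f\<^sup>2) + c * (\<mu> - \<rho>) * W * F / f"
  proof -
    have "F / f * B = F / f\<^sup>2 * (f * B)" using nz by (simp add: field_simps power2_eq_square)
    then show ?thesis unfolding B using nz by (simp add: field_simps power2_eq_square)
  qed
  have "F / f * (2 * Q + 2 * ((c * (m + 3 * r) * f + c * (\<mu> + 3 * \<rho>)) * W) + 2 * B) =
      2 * Q * F / f + 2 * c * F * W * m + 6 * c * F * W * r + 2 * c * (\<mu> + 3 * \<rho>) * F * W / f + 2 * (F / f * B)"
    using nz by (simp add: field_simps)
  also have "6 * c * F * W * r = - 6 * c * F * W * (\<mu> + \<rho>) / f"
  proof -
    have r': "r = - (\<mu> + \<rho>) / f" using r nz by (simp add: field_simps)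
    show ?thesis unfolding r' using nz by (simp add: field_simps)
  qed
  finally have expand: "F / f * (2 * Q + 2 * ((c * (m + 3 * r) * f + c * (\<mu> + 3 * \<rho>)) * W) + 2 * B) =
      2 * Q * F / f + 2 * c * F * W * m + - 6 * c * F * W * (\<mu> + \<rho>) / f
      + 2 * c * (\<mu> + 3 * \<rho>) * F * W / f + 2 * (F / f * B)" .
  have boch: "F / f * (2 * Q + 2 * ((c * (m + 3 * r) * f + c * (\<mu> + 3 * \<rho>)) * W) + 2 * B) =
      2 * Q * F / f + 2 * c * F * W * m - 2 * c * (\<mu> + \<rho>) * F * W / f + F * N / f\<^sup>2"
    unfolding expand Bf using nz by (simp add: field_simps power2_eq_square)
  have F'1: "F' / f = 12 * F / D - G"
    unfolding F' using nz by simp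
  have F'2: "2 * c * (\<mu> - \<rho>) * F' = 24 * c * f * F / D * (\<mu> - \<rho>) - 2 * c * (\<mu> - \<rho>) * f * G"
    unfolding F' using nz by (simp add: field_simps)
  have r1: "2 * c * (m - r) * F = 2 * c * F * m + 2 * c * F * (\<mu> + \<rho>) / f"
  proof -
    have r': "r = - (\<mu> + \<rho>) / f" using r nz by (simp add: field_simps)
    show ?thesis unfolding r' using nz by (simp add: field_simps)
  qed
  have GL: "G * W * L = c * W * (\<mu> + 3 * \<rho>) * f * G" unfolding L by simp
  show ?thesis
    unfolding boch cot sq F'1 F'2 r1 G' distrib_right[of _ "G * W" L] GL
    using LL by (simp add: algebra_simps power2_eq_square)
qed

lemma (in metric_chart) gnorm2_add_scaleR_grad:
  assumes p: "p \<in> chart_dom ch"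
  shows "gnorm2 g ch p (grad g ch u p + k *\<^sub>R grad g ch v p) =
    gnorm2 g ch p (grad g ch u p) + 2 * k * ginner g ch p (grad g ch u p) (grad g ch v p)
      + k\<^sup>2 * gnorm2 g ch p (grad g ch v p)"
proof -
  have "ginner g ch p (grad g ch v p) (grad g ch u p) = ginner g ch p (grad g ch u p) (grad g ch v p)"
    by (simp add: ginner_grad[OF p] cometric_commute[OF p, of "\<lambda>i. pd ch i v p"])
  then show ?thesis
    by (simp add: gnorm2_def ginner_def matrix_vector_right_distrib matrix_vector_mult_scaleR
        inner_add_left inner_add_right power2_eq_square algebra_simps)
qed

lemma (in fluid_chart) ricci_lapse:
  assumes p: "p \<in> chart_dom ch"
  shows "f p * cometric p (\<lambda>i. cometric p (\<lambda>j. pd ch j f p) (\<lambda>j. Ric j i p)) (\<lambda>i. pd ch i f p) =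
    cometric p (\<lambda>i. cometric p (\<lambda>j. hessian g ch f i j p) (\<lambda>j. pd ch j f p)) (\<lambda>i. pd ch i f p)
    + 4 * pi * (\<mu> p - \<rho> p) * f p * cometric p (\<lambda>i. pd ch i f p) (\<lambda>i. pd ch i f p)"
proof -
  have "cometric p (\<lambda>j. gd j i p) \<alpha> = \<alpha> i" for \<alpha> i
  proof -
    have "cometric p (\<lambda>j. gd j i p) \<alpha> = (\<Sum>a\<in>UNIV. gd i a p * (\<Sum>b\<in>UNIV. gu a b p * \<alpha> b))"
      by (simp add: cometric_def sum_distrib_left gd_commute[OF p, of i] mult_ac)
    then show ?thesis by (simp add: gd_gu_cancel[OF p])
  qed
  moreover have "f p * cometric p (\<lambda>j. Ric j i p) \<alpha> = cometric p (\<lambda>j. hessian g ch f i j p) \<alpha>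
      + 4 * pi * (\<mu> p - \<rho> p) * f p * cometric p (\<lambda>j. gd j i p) \<alpha>" for \<alpha> i
    unfolding cometric_scale_left[symmetric] einstein[OF p] cometric_add_left
    by (simp add: hessian_commute[OF smooth_fluid(1) p, of i])
  ultimately have "f p * cometric p (\<lambda>j. pd ch j f p) (\<lambda>j. Ric j i p) =
      cometric p (\<lambda>j. hessian g ch f i j p) (\<lambda>j. pd ch j f p)
      + 4 * pi * (\<mu> p - \<rho> p) * f p * pd ch i f p" for i
    using cometric_commute[OF p, of "\<lambda>j. pd ch j f p"] by simp
  then show ?thesis
    unfolding cometric_scale_left[symmetric] cometric_add_left by (simp add: cometric_add_left cometric_scale_left)
qed

text \<open>The divergence formula for any weights that satisfy the two differential equations at the
  value of \<open>f\<close>.\<close>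

lemma (in fluid_chart) divergence_identity:
  fixes F G :: "real \<Rightarrow> real"
  defines "W \<equiv> \<lambda>q. gnorm2 g ch q (grad g ch f q)"
  assumes p: "p \<in> chart_dom ch" and W_nz: "W p \<noteq> 0" and f_nz: "1 - (f p)\<^sup>2 \<noteq> 0"
    and F: "(F has_real_derivative F') (at (f p))" and G: "(G has_real_derivative G') (at (f p))"
    and F': "F' = f p * (12 * F (f p) / (1 - (f p)\<^sup>2) - G (f p))"
    and G': "G' = 48 * f p * F (f p) / (1 - (f p)\<^sup>2)\<^sup>2"
    and m: "\<And>i. pd ch i \<mu> p = m * pd ch i f p"
  shows "divergence g ch (\<lambda>q.
         F (f q) *\<^sub>R ((1 / f q) *\<^sub>R grad g ch W q + (8 * pi * (\<mu> q - \<rho> q)) *\<^sub>R grad g ch f q)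
         + (G (f q) * W q) *\<^sub>R grad g ch f q) p
     = F (f p) * (f p) ^ 3 * tensor3_norm2 g ch (cotton g ch) p / (4 * W p)
       - F (f p) * laplacian g ch f p / (f p * W p) * ginner g ch p (grad g ch W p) (grad g ch f p)
       + 3 * F (f p) / (4 * f p * W p) *
           gnorm2 g ch p (grad g ch W p + (8 * (f p * W p / (1 - (f p)\<^sup>2))) *\<^sub>R grad g ch f p)
       + 4 * pi * (3 * \<mu> p + \<rho> p) * F (f p) * laplacian g ch f p
       + 96 * pi * f p * F (f p) / (1 - (f p)\<^sup>2) * W p * (\<mu> p - \<rho> p)
       + 4 * pi * W p * ((5 * \<rho> p - \<mu> p) * f p * G (f p) + 4 * F (f p) * m)"
proof -
  note smooth = smooth_fluid
  have f: "f p \<noteq> 0" using lapse_pos[OF p] by simp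
  define df where "df i = pd ch i f p" for i
  define dW where "dW i = pd ch i W p" for i
  define L where "L = laplacian g ch f p"
  define Q where "Q = (\<Sum>a\<in>UNIV. \<Sum>b\<in>UNIV. gu a b p *
      cometric p (\<lambda>i. hessian g ch f b i p) (\<lambda>i. hessian g ch f a i p))"
  define v where "v i = cometric p (\<lambda>j. hessian g ch f i j p) df" for i
  define B where "B = cometric p (\<lambda>i. cometric p df (\<lambda>j. Ric j i p)) df"
  define r where "r = - (\<mu> p + \<rho> p) / f p"
  define N where "N = cometric p dW df"
  define M where "M = cometric p dW dW"
  have smooth_W: "smooth W" unfolding W_def by (rule smooth_gnorm2_grad[OF smooth(1)])
  have W: "W p = cometric p df df"
    by (simp add: W_def df_def[abs_def] gnorm2_def ginner_grad[OF p])
  have dW: "dW = (\<lambda>i. 2 * v i)"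
    by (simp add: fun_eq_iff dW_def W_def v_def df_def[abs_def] pd_gnorm2_grad[OF p smooth(1)])
  have scale_right: "cometric p \<alpha> (\<lambda>i. k * \<beta> i) = k * cometric p \<alpha> \<beta>" for \<alpha> \<beta> k
    by (simp add: cometric_commute[OF p, of \<alpha>] cometric_scale_left)
  have vN: "cometric p v df = N / 2" "cometric p v v = M / 4"
    by (simp_all add: N_def M_def dW cometric_scale_left scale_right)
  have r: "pd ch i \<rho> p = r * df i" for i
    by (simp add: pd_pressure[OF p] r_def df_def)
  have m: "pd ch i \<mu> p = m * df i" for i by (simp add: m df_def)
  have T: "(f p)^4 * tensor3_norm2 g ch (cotton g ch) p = 8 * W p * Q - 3 * M + 4 * L * N - 4 * L\<^sup>2 * W p"
    using cotton_norm_fluid[OF p, folded df_def[abs_def] v_def[abs_def] Q_def L_def W]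
    by (simp add: df_def[symmetric] v_def[symmetric] vN W)
  have B: "f p * B = N / 2 + 4 * pi * (\<mu> p - \<rho> p) * f p * W p"
    using ricci_lapse[OF p] unfolding df_def[symmetric] v_def[symmetric]
    by (simp add: B_def vN W)
  have lap_W: "laplacian g ch W p = 2 * Q + 2 * ((4 * pi * (m + 3 * r) * f p + 4 * pi * (\<mu> p + 3 * \<rho> p)) * W p) + 2 * B"
  proof -
    have "pd ch i (laplacian g ch f) p = (4 * pi * (m + 3 * r) * f p + 4 * pi * (\<mu> p + 3 * \<rho> p)) * df i" for i
      unfolding pd_laplacian_lapse[OF p] m r by (simp add: df_def algebra_simps)
    then show ?thesis
      unfolding W_def bochner[OF p smooth(1)] df_def[symmetric] Q_def[symmetric]
      by (simp add: cometric_scale_left B_def W[unfolded W_def])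
  qed
  \<comment> \<open>The vector field is \<open>\<alpha> \<nabla>W + \<beta> \<nabla>f\<close>.\<close>
  define \<alpha> where "\<alpha> q = F (f q) * (1 / f q)" for q
  define \<beta> where "\<beta> q = F (f q) * (8 * pi * (\<mu> q - \<rho> q)) + G (f q) * W q" for q
  have Ff: "diff_at (\<lambda>q. F (f q)) p" "pd ch i (\<lambda>q. F (f q)) p = F' * df i" for i
    using diff_at_compose[of f p F, OF _ F p] pd_compose[of f p F, OF _ F p] smooth(1) p
    by (simp_all add: smooth_imp_diff_at df_def)
  have Gf: "diff_at (\<lambda>q. G (f q)) p" "pd ch i (\<lambda>q. G (f q)) p = G' * df i" for i
    using diff_at_compose[of f p G, OF _ G p] pd_compose[of f p G, OF _ G p] smooth(1) p
    by (simp_all add: smooth_imp_diff_at df_def)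
  have "((\<lambda>t. F t * (1 / t)) has_real_derivative F' / f p - F (f p) / (f p)\<^sup>2) (at (f p))"
    using f by (auto intro!: derivative_eq_intros F simp: field_simps power2_eq_square)
  from diff_at_compose[of f p "\<lambda>t. F t * (1 / t)", OF _ this p]
    pd_compose[of f p "\<lambda>t. F t * (1 / t)", OF _ this p]
  have \<alpha>: "diff_at \<alpha> p" "pd ch i \<alpha> p = (F' / f p - F (f p) / (f p)\<^sup>2) * df i" for i
    using smooth(1) p by (simp_all add: \<alpha>_def[abs_def] smooth_imp_diff_at df_def)
  define \<sigma> where "\<sigma> q = 8 * pi * (\<mu> q - \<rho> q)" for q
  have \<sigma>: "diff_at \<sigma> p" "pd ch i \<sigma> p = 8 * pi * (m - r) * df i" for i
    unfolding \<sigma>_def[abs_def]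
    using p smooth by (simp_all add: smooth_imp_diff_at smooth_intros pd_simps diff_at_intros m r algebra_simps)
  have \<beta>_eq: "\<beta> = (\<lambda>q. F (f q) * \<sigma> q + G (f q) * W q)"
    by (simp add: \<beta>_def \<sigma>_def fun_eq_iff)
  have "pd ch i \<beta> p = F' * df i * \<sigma> p + F (f p) * (8 * pi * (m - r) * df i)
      + (G' * df i * W p + G (f p) * dW i)" for i
    unfolding \<beta>_eq using p Ff Gf \<sigma> smooth_W
    by (simp add: pd_add pd_mult diff_at_add diff_at_mult smooth_imp_diff_at dW_def)
  then have \<beta>: "diff_at \<beta> p"
    "pd ch i \<beta> p = (8 * pi * (\<mu> p - \<rho> p) * F' + 8 * pi * (m - r) * F (f p) + G' * W p) * df i
      + G (f p) * dW i" for i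
    using p Ff Gf \<sigma> smooth_W
    by (simp_all add: \<beta>_eq diff_at_add diff_at_mult smooth_imp_diff_at)
      (simp add: \<sigma>_def algebra_simps)
  have "divergence g ch (\<lambda>q.
         F (f q) *\<^sub>R ((1 / f q) *\<^sub>R grad g ch W q + (8 * pi * (\<mu> q - \<rho> q)) *\<^sub>R grad g ch f q)
         + (G (f q) * W q) *\<^sub>R grad g ch f q) p =
      divergence g ch (\<lambda>q. \<alpha> q *\<^sub>R grad g ch W q + \<beta> q *\<^sub>R grad g ch f q) p"
    by (simp add: \<alpha>_def \<beta>_def scaleR_add_right scaleR_add_left add.assoc)
  also have "\<dots> = divergence g ch (\<lambda>q. \<alpha> q *\<^sub>R grad g ch W q) p + divergence g ch (\<lambda>q. \<beta> q *\<^sub>R grad g ch f q) p"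
    using p smooth(1) smooth_W \<alpha>(1) \<beta>(1)
    by (intro divergence_add) (simp_all add: diff_at_mult diff_at_grad)
  also have "\<dots> = F (f p) / f p * laplacian g ch W p + (F' / f p - F (f p) / (f p)\<^sup>2) * N
      + (2 * (4 * pi) * (\<mu> p - \<rho> p) * F (f p) + G (f p) * W p) * L
      + (2 * (4 * pi) * (\<mu> p - \<rho> p) * F' + 2 * (4 * pi) * (m - r) * F (f p) + G' * W p) * W p + G (f p) * N"
    unfolding divergence_scaled_grad[OF p smooth_W \<alpha>(1)] divergence_scaled_grad[OF p smooth(1) \<beta>(1)]
      \<alpha>(2) \<beta>(2) cometric_add_left cometric_scale_left df_def[symmetric] dW_def[symmetric]
      L_def[symmetric] N_def[symmetric] W[symmetric]
    by (simp add: \<alpha>_def \<beta>_def N_def cometric_commute[OF p, of df dW] mult.commute)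
  also have "\<dots> = F (f p) * (f p) ^ 3 * tensor3_norm2 g ch (cotton g ch) p / (4 * W p)
      - F (f p) * L / (f p * W p) * N
      + 3 * F (f p) / (4 * f p * W p) * (M + 2 * (8 * (f p * W p / (1 - (f p)\<^sup>2))) * N
          + (8 * (f p * W p / (1 - (f p)\<^sup>2)))\<^sup>2 * W p)
      + 4 * pi * (3 * \<mu> p + \<rho> p) * F (f p) * L + 24 * (4 * pi) * f p * F (f p) / (1 - (f p)\<^sup>2) * W p * (\<mu> p - \<rho> p)
      + 4 * pi * W p * ((5 * \<rho> p - \<mu> p) * f p * G (f p) + 4 * F (f p) * m)"
    unfolding lap_W
    by (rule divergence_balance[OF f W_nz f_nz T B _ _ F' G'])
      (simp_all add: L_def laplacian_lapse[OF p] r_def f)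
  finally show ?thesis
    unfolding gnorm2_add_scaleR_grad[OF p] ginner_grad[OF p] dW_def[symmetric] df_def[symmetric]
    by (simp add: L_def N_def M_def gnorm2_def ginner_grad[OF p] W dW_def[symmetric] df_def[symmetric])
qed

text \<open>The family \<open>F\<close>, with its two parameters, solves the second-order equation that is left after
  \<open>G\<close> has been eliminated from the two conditions for completing the square.\<close>

lemma profile_derivatives:
  fixes c d t :: real and F G :: "real \<Rightarrow> real"
  assumes F_def: "F = (\<lambda>t. (c * t\<^sup>2 + d) * (1 - t\<^sup>2) powi (-3))"
    and G_def: "G = (\<lambda>t. 6 * F t / (1 - t\<^sup>2) - 2 * c * (1 - t\<^sup>2) powi (-3))"
    and t: "1 - t\<^sup>2 \<noteq> 0"
  shows "(F has_real_derivative t * (12 * F t / (1 - t\<^sup>2) - G t)) (at t)"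
    and "(G has_real_derivative 48 * t * F t / (1 - t\<^sup>2)\<^sup>2) (at t)"
proof -
  define D where "D = 1 - t\<^sup>2"
  have D: "D \<noteq> 0" using t by (simp add: D_def)
  have F: "F = (\<lambda>t. (c * t\<^sup>2 + d) / (1 - t\<^sup>2)^3)"
    by (simp add: F_def power_int_minus divide_inverse)
  have G: "G = (\<lambda>t. 6 * F t / (1 - t\<^sup>2) - 2 * c / (1 - t\<^sup>2)^3)"
    by (simp add: G_def power_int_minus divide_inverse)
  have cube: "((\<lambda>t. (1 - t\<^sup>2)^3) has_real_derivative - 6 * t * D\<^sup>2) (at t)"
    by (auto intro!: derivative_eq_intros simp: D_def power2_eq_square)
  have "(F has_real_derivative ((2 * c * t) * D^3 - (c * t\<^sup>2 + d) * (- 6 * t * D\<^sup>2)) / (D^3 * D^3)) (at t)"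
    unfolding F
    by (rule DERIV_divide[OF _ cube, folded D_def, THEN DERIV_cong])
      (use D in \<open>auto intro!: derivative_eq_intros\<close>)
  also have "((2 * c * t) * D^3 - (c * t\<^sup>2 + d) * (- 6 * t * D\<^sup>2)) / (D^3 * D^3) =
      t * (12 * F t / D - G t)"
    unfolding G F D_def[symmetric] using D by (simp add: field_simps power_numeral_reduce)
  finally show F': "(F has_real_derivative t * (12 * F t / (1 - t\<^sup>2) - G t)) (at t)"
    unfolding D_def .
  have "(G has_real_derivative (6 * (t * (12 * F t / D - G t)) * D - 6 * F t * (- 2 * t)) / (D * D)
      - (0 * D^3 - 2 * c * (- 6 * t * D\<^sup>2)) / (D^3 * D^3)) (at t)"
    unfolding G
    using D cube F' unfolding D_def G
    by (auto intro!: derivative_eq_intros simp: power2_eq_square)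
  also have "(6 * (t * (12 * F t / D - G t)) * D - 6 * F t * (- 2 * t)) / (D * D)
      - (0 * D^3 - 2 * c * (- 6 * t * D\<^sup>2)) / (D^3 * D^3) = 48 * t * F t / D\<^sup>2"
    unfolding G F D_def[symmetric] using D by (simp add: field_simps power_numeral_reduce)
  finally show "(G has_real_derivative 48 * t * F t / (1 - t\<^sup>2)\<^sup>2) (at t)"
    unfolding D_def .
qed

lemma fluid_chartI:
  assumes "static_perfect_fluid X A g f \<mu> \<rho>" "ch \<in> A"
  shows "fluid_chart ch g f \<mu> \<rho>"
proof -
  have man: "smooth_manifold X A" and met: "riemannian_metric A g"
    and smooth_data: "smooth_function A f" "smooth_function A \<mu>" "smooth_function A \<rho>"
    and pos: "\<And>p. p \<in> topspace X \<Longrightarrow> f p > 0"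
    and eqs: "\<And>p i j. p \<in> chart_dom ch \<Longrightarrow> f p * ricci g ch i j p =
           hessian g ch f i j p + 4 * pi * (\<mu> p - \<rho> p) * f p * g ch p $ i $ j"
      "\<And>p. p \<in> chart_dom ch \<Longrightarrow> laplacian g ch f p = 4 * pi * (\<mu> p + 3 * \<rho> p) * f p"
    using assms unfolding static_perfect_fluid_def by auto
  have dom: "chart_dom ch \<subseteq> topspace X"
    using man assms(2) unfolding smooth_manifold_def by auto
  have hom: "homeomorphic_map (subtopology X (chart_dom ch)) (top_of_set (chart_image ch)) (snd ch)"
    and op: "open (chart_image ch)"
    using man assms(2) unfolding smooth_manifold_def by auto
  interpret coordinate_chart ch
  proof
    show "inj_on (snd ch) (chart_dom ch)"
      using hom dom by (simp add: homeomorphic_map_def inf.absorb2)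
  qed (rule op)
  interpret metric_chart ch g
    by unfold_locales (use met assms(2) in \<open>auto simp: riemannian_metric_def smooth_def comp_def\<close>)
  show ?thesis
    by unfold_locales
      (use smooth_data assms(2) pos dom eqs in \<open>auto simp: smooth_function_def smooth_def\<close>)
qed

theorem lemma2p4:
  fixes X :: "'a topology" and A :: "('a, 3) chart set" and g :: "('a, 3) metric"
    and f \<mu> \<rho> :: "'a \<Rightarrow> real"
    and h :: "real \<Rightarrow> real" and J :: "real set"
    and c d :: real and F G :: "real \<Rightarrow> real" and dmudf :: "'a \<Rightarrow> real"
  assumes fluid: "static_perfect_fluid X A g f \<mu> \<rho>"
    and h: "open J" "smooth_on J h"
    and mu_rho: "\<And>p. p \<in> topspace X \<Longrightarrow> \<rho> p \<in> J \<and> \<mu> p = h (\<rho> p)"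
    and F: "F = (\<lambda>t. (c * t\<^sup>2 + d) * (1 - t\<^sup>2) powi (-3))"
    and G: "G = (\<lambda>t. 6 * F t / (1 - t\<^sup>2) - 2 * c * (1 - t\<^sup>2) powi (-3))"
    and dmudf: "dmudf = (\<lambda>p. - (\<mu> p + \<rho> p) / f p * deriv h (\<rho> p))"
  shows "\<forall>ch\<in>A. \<forall>p\<in>chart_dom ch. grad g ch f p \<noteq> 0 \<and> f p \<noteq> 1 \<longrightarrow>
    (let W = (\<lambda>q. gnorm2 g ch q (grad g ch f q)) in
     divergence g ch (\<lambda>q.
         F (f q) *\<^sub>R ((1 / f q) *\<^sub>R grad g ch W q + (8 * pi * (\<mu> q - \<rho> q)) *\<^sub>R grad g ch f q)
         + (G (f q) * W q) *\<^sub>R grad g ch f q) p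
     = F (f p) * (f p) ^ 3 * tensor3_norm2 g ch (cotton g ch) p / (4 * W p)
       - F (f p) * laplacian g ch f p / (f p * W p) * ginner g ch p (grad g ch W p) (grad g ch f p)
       + 3 * F (f p) / (4 * f p * W p) *
           gnorm2 g ch p (grad g ch W p + (8 * (f p * W p / (1 - (f p)\<^sup>2))) *\<^sub>R grad g ch f p)
       + 4 * pi * (3 * \<mu> p + \<rho> p) * F (f p) * laplacian g ch f p
       + 96 * pi * f p * F (f p) / (1 - (f p)\<^sup>2) * W p * (\<mu> p - \<rho> p)
       + 4 * pi * W p * ((5 * \<rho> p - \<mu> p) * f p * G (f p) + 4 * F (f p) * dmudf p))"
proof (intro ballI impI)
  fix ch p
  assume ch: "ch \<in> A" and p: "p \<in> chart_dom ch" and nz: "grad g ch f p \<noteq> 0 \<and> f p \<noteq> 1"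
  interpret fluid_chart ch g f \<mu> \<rho> by (rule fluid_chartI[OF fluid ch])
  have dom: "chart_dom ch \<subseteq> topspace X"
    using fluid ch unfolding static_perfect_fluid_def smooth_manifold_def by auto
  have D: "1 - (f p)\<^sup>2 \<noteq> 0"
    using nz lapse_pos[OF p] by (auto simp: power2_eq_1_iff)
  have W: "gnorm2 g ch p (grad g ch f p) \<noteq> 0"
    using posdef_metric[OF p, of "grad g ch f p"] nz by (simp add: gnorm2_def ginner_def)
  have "(h has_real_derivative deriv h (\<rho> p)) (at (\<rho> p))"
    using smooth_on_imp_differentiable[OF h(2), of "\<rho> p"] mu_rho[of p] dom p
    by (auto simp: DERIV_deriv_iff_real_differentiable)
  from pd_compose[of \<rho> p h, OF _ this p]
  have "pd ch i (\<lambda>q. h (\<rho> q)) p = deriv h (\<rho> p) * pd ch i \<rho> p" for i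
    using p smooth_fluid by (simp add: smooth_imp_diff_at)
  moreover have "pd ch i \<mu> p = pd ch i (\<lambda>q. h (\<rho> q)) p" for i
    using mu_rho dom p by (intro pd_cong) (auto simp: smooth_imp_diff_at smooth_fluid)
  ultimately have m: "pd ch i \<mu> p = dmudf p * pd ch i f p" for i
    by (simp add: pd_pressure[OF p] dmudf)
  show "let W = (\<lambda>q. gnorm2 g ch q (grad g ch f q)) in
     divergence g ch (\<lambda>q.
         F (f q) *\<^sub>R ((1 / f q) *\<^sub>R grad g ch W q + (8 * pi * (\<mu> q - \<rho> q)) *\<^sub>R grad g ch f q)
         + (G (f q) * W q) *\<^sub>R grad g ch f q) p
     = F (f p) * (f p) ^ 3 * tensor3_norm2 g ch (cotton g ch) p / (4 * W p)
       - F (f p) * laplacian g ch f p / (f p * W p) * ginner g ch p (grad g ch W p) (grad g ch f p)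
       + 3 * F (f p) / (4 * f p * W p) *
           gnorm2 g ch p (grad g ch W p + (8 * (f p * W p / (1 - (f p)\<^sup>2))) *\<^sub>R grad g ch f p)
       + 4 * pi * (3 * \<mu> p + \<rho> p) * F (f p) * laplacian g ch f p
       + 96 * pi * f p * F (f p) / (1 - (f p)\<^sup>2) * W p * (\<mu> p - \<rho> p)
       + 4 * pi * W p * ((5 * \<rho> p - \<mu> p) * f p * G (f p) + 4 * F (f p) * dmudf p)"
    unfolding Let_def
    by (rule divergence_identity[OF p W D profile_derivatives(1)[OF F G D]
          profile_derivatives(2)[OF F G D] refl refl m])
qed

end
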